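(* For each $n$, let $p=p(n)$ and $\rho=\rho(n)\in\mathbb{R}^p$, and let $\sigma>0$ be a fixed constant. Observe $x_1,\dots,x_n\in\mathbb{R}^p$ from the single component model $$x_i = v_i\rho+\sigma z_i,\qquad i=1,\dots,n,$$ where $v_1,\dots,v_n$ are i.i.d. $N(0,1)$, $z_1,\dots,z_n$ are i.i.d. $N_p(0,I_p)$, and all the $v_i$ and $z_i$ are mutually independent. Assume $\lim_{n\to\infty}\|\rho(n)\|=\varrho>0$ and $\lim_{n\to\infty}p(n)/n=c$ with $0<c<\infty$. Let $S=n^{-1}\sum_{i=1}^n x_ix_i^T$ and let $\hat\rho$ be a unit eigenvector of $S$ associated with its largest eigenvalue. Then $\hat\rho$ is inconsistent: $$\liminf_{n\to\infty} E\,\angle(\hat\rho,\rho)>0.$$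
   Context: For nonzero $\xi,\eta\in\mathbb{R}^p$, the angle is $\angle(\xi,\eta)=\cos^{-1}\bigl(|\xi^T\eta|/(\|\xi\|_2\|\eta\|_2)\bigr)\in[0,\pi/2]$. All quantities $p,\rho$ may depend on $n$; $\sigma$ does not. *)

theory Defs
  imports "HOL-Probability.Probability" "Jordan_Normal_Form.Char_Poly"
begin

definition vangle :: "real vec \<Rightarrow> real vec \<Rightarrow> real" where
  "vangle u w = arccos (\<bar>u \<bullet> w\<bar> / (sqrt (u \<bullet> u) * sqrt (w \<bullet> w)))"

definition sample_cov :: "nat \<Rightarrow> nat \<Rightarrow> (nat \<Rightarrow> nat \<Rightarrow> real) \<Rightarrow> real mat" where
  "sample_cov n p x = mat p p (\<lambda>(j, k). (\<Sum>i<n. x i j * x i k) / real n)"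

definition top_unit_eigenvector :: "real mat \<Rightarrow> real vec \<Rightarrow> bool" where
  "top_unit_eigenvector A u \<longleftrightarrow> u \<bullet> u = 1 \<and>
     (\<exists>l. eigenvector A u l \<and> (\<forall>l'. eigenvalue A l' \<longrightarrow> l' \<le> l))"

end

theory Submission
  imports Defs
begin

text \<open>
  Let \<open>e = \<rho> / \<parallel>\<rho>\<parallel>\<close>, \<open>a = e\<^sup>T S e\<close> and let \<open>R = S e - a e\<close> be the residual of \<open>e\<close> as an approximate
  eigenvector. If \<open>u\<close> is a top unit eigenvector of \<open>S\<close> at angle \<open>\<theta>\<close> from \<open>e\<close>, testing
  \<open>S u = \<lambda> u\<close> against \<open>e\<close> bounds \<open>\<lambda>\<close> by \<open>a + \<parallel>R\<parallel> tan \<theta>\<close>, and testing it against \<open>R\<close> gives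
  \<open>\<parallel>R\<parallel> cos \<theta> \<le> 2 \<lambda> sin \<theta>\<close>; hence \<open>sin \<theta> \<ge> min (1/4) (\<parallel>R\<parallel> / (8 a))\<close>, and no bound on the
  operator norm of the noise is needed. It remains to see that, with probability bounded away from
  zero, \<open>a\<close> is bounded and \<open>\<parallel>R\<parallel>\<close> is bounded below. The first is Markov's inequality. For the second,
  the law of the sample is invariant under \<open>v \<mapsto> -v\<close>, and this flip changes \<open>R\<close> by
  \<open>2 \<sigma> \<parallel>\<rho>\<parallel> / n\<close> times the projection of \<open>Z\<^sup>T v\<close> orthogonal to \<open>e\<close>. The squared norm of that
  projection has mean \<open>n (p - 1)\<close> and second moment at most \<open>12 n\<^sup>2 p\<^sup>2\<close>, so the Paley-Zygmund
  inequality applies.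
\<close>

section \<open>Rayleigh quotients of sample covariance matrices\<close>

text \<open>Vectors are total functions of which only the coordinates below \<open>p\<close> count,
  so linear identities carry no dimension side conditions; \<open>scalar_prod_eq_dot\<close> gives
  the link with \<open>real vec\<close>.\<close>

definition dot :: "nat \<Rightarrow> (nat \<Rightarrow> real) \<Rightarrow> (nat \<Rightarrow> real) \<Rightarrow> real" where
  "dot p f g = (\<Sum>j<p. f j * g j)"

lemma dot_commute: "dot p f g = dot p g f"
  by (simp add: dot_def mult.commute)

lemma dot_linear_left [simp]:
  "dot p (\<lambda>j. f j + g j) h = dot p f h + dot p g h"
  "dot p (\<lambda>j. f j - g j) h = dot p f h - dot p g h"
  "dot p (\<lambda>j. c * f j) h = c * dot p f h"
  by (simp_all add: dot_def sum.distrib sum_subtractf sum_distrib_left algebra_simps)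

lemma dot_linear_right [simp]:
  "dot p h (\<lambda>j. f j + g j) = dot p h f + dot p h g"
  "dot p h (\<lambda>j. f j - g j) = dot p h f - dot p h g"
  "dot p h (\<lambda>j. c * f j) = c * dot p h f"
  by (simp_all add: dot_commute[of p h])

lemma dot_self_nonneg [simp]: "dot p f f \<ge> 0"
  by (simp add: dot_def sum_nonneg)

lemma dot_Cauchy_Schwarz: "(dot p f g)\<^sup>2 \<le> dot p f f * dot p g g"
  using Cauchy_Schwarz_ineq_sum[of f g "{..<p}"] by (simp add: dot_def power2_eq_square)

lemma dot_cong: "(\<And>j. j < p \<Longrightarrow> f j = f' j) \<Longrightarrow> (\<And>j. j < p \<Longrightarrow> g j = g' j) \<Longrightarrow> dot p f g = dot p f' g'"
  by (simp add: dot_def)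

lemma dot_delta: "j < p \<Longrightarrow> dot p f (\<lambda>k. if k = j then 1 else 0) = f j"
  by (simp add: dot_def mult_delta_right)

text \<open>The bilinear form of the sample covariance matrix \<open>S\<close>, written through the
  data rows so that positivity and Cauchy-Schwarz are visible; \<open>cov_map\<close> below is the
  action of \<open>S\<close>.\<close>

definition cov_form :: "nat \<Rightarrow> nat \<Rightarrow> (nat \<Rightarrow> nat \<Rightarrow> real) \<Rightarrow> (nat \<Rightarrow> real) \<Rightarrow> (nat \<Rightarrow> real) \<Rightarrow> real" where
  "cov_form n p x f g = (\<Sum>i<n. dot p (x i) f * dot p (x i) g) / real n"

definition cov_map :: "nat \<Rightarrow> nat \<Rightarrow> (nat \<Rightarrow> nat \<Rightarrow> real) \<Rightarrow> (nat \<Rightarrow> real) \<Rightarrow> nat \<Rightarrow> real" where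
  "cov_map n p x f j = (\<Sum>i<n. dot p (x i) f * x i j) / real n"

lemma cov_form_commute: "cov_form n p x f g = cov_form n p x g f"
  by (simp add: cov_form_def mult.commute)

lemma cov_form_linear_left [simp]:
  "cov_form n p x (\<lambda>j. f j + g j) h = cov_form n p x f h + cov_form n p x g h"
  "cov_form n p x (\<lambda>j. f j - g j) h = cov_form n p x f h - cov_form n p x g h"
  "cov_form n p x (\<lambda>j. c * f j) h = c * cov_form n p x f h"
  by (simp_all add: cov_form_def algebra_simps sum.distrib sum_subtractf add_divide_distrib
      diff_divide_distrib sum_distrib_left)

lemma cov_form_linear_right [simp]:
  "cov_form n p x h (\<lambda>j. f j + g j) = cov_form n p x h f + cov_form n p x h g"
  "cov_form n p x h (\<lambda>j. f j - g j) = cov_form n p x h f - cov_form n p x h g"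
  "cov_form n p x h (\<lambda>j. c * f j) = c * cov_form n p x h f"
  by (simp_all add: cov_form_commute[of n p x h])

lemma cov_form_self_nonneg [simp]: "cov_form n p x f f \<ge> 0"
  by (simp add: cov_form_def sum_nonneg)

lemma cov_form_Cauchy_Schwarz: "(cov_form n p x f g)\<^sup>2 \<le> cov_form n p x f f * cov_form n p x g g"
proof -
  have "(\<Sum>i<n. dot p (x i) f * dot p (x i) g)\<^sup>2
      \<le> (\<Sum>i<n. (dot p (x i) f)\<^sup>2) * (\<Sum>i<n. (dot p (x i) g)\<^sup>2)"
    by (rule Cauchy_Schwarz_ineq_sum)
  then show ?thesis
    by (simp add: cov_form_def power2_eq_square divide_right_mono)
qed

lemma dot_cov_map: "dot p f (cov_map n p x g) = cov_form n p x f g"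
proof -
  have "dot p f (cov_map n p x g) = (\<Sum>j<p. \<Sum>i<n. f j * (dot p (x i) g * x i j)) / real n"
    by (simp add: dot_def cov_map_def sum_divide_distrib sum_distrib_left)
  also have "\<dots> = (\<Sum>i<n. \<Sum>j<p. f j * (dot p (x i) g * x i j)) / real n"
    by (subst sum.swap) simp
  also have "\<dots> = cov_form n p x f g"
    by (simp add: cov_form_def dot_def[of p _ f] sum_distrib_left sum_distrib_right algebra_simps)
  finally show ?thesis .
qed

section \<open>Existence of a top eigenvector by maximising the Rayleigh quotient\<close>

text \<open>Setting the coordinates from \<open>p\<close> on to zero makes the sphere a closed
  subset of a product of intervals \<open>[-1, 1]\<close>, which is compact by Tychonoff.\<close>

lemma compact_unit_sphere: "compact {f :: nat \<Rightarrow> real. (\<forall>j\<ge>p. f j = 0) \<and> dot p f f = 1}"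
proof -
  let ?S = "{f :: nat \<Rightarrow> real. (\<forall>j\<ge>p. f j = 0) \<and> dot p f f = 1}"
  let ?B = "PiE UNIV (\<lambda>_. {-1..1}) :: (nat \<Rightarrow> real) set"
  have "compactin (product_topology (\<lambda>_. euclidean) UNIV) ?B"
    by (subst compactin_PiE) auto
  then have "compact ?B"
    by (simp add: euclidean_product_topology)
  moreover have "closed ?S"
  proof -
    have "?S = (\<Inter>j\<in>{p..}. {f. f j = 0}) \<inter> {f. dot p f f = 1}" by auto
    moreover have "closed {f :: nat \<Rightarrow> real. f j = 0}" for j
      by (intro closed_Collect_eq continuous_intros continuous_on_product_coordinates)
    moreover have "closed {f :: nat \<Rightarrow> real. dot p f f = 1}"
      unfolding dot_def
      by (intro closed_Collect_eq continuous_intros continuous_on_product_coordinates)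
    ultimately show ?thesis by (metis (no_types, lifting) closed_INT closed_Int)
  qed
  moreover have "?S \<subseteq> ?B"
  proof
    fix f assume f: "f \<in> ?S"
    have "f j \<in> {-1..1}" for j
    proof (cases "j < p")
      case True
      have "f j * f j \<le> dot p f f"
        unfolding dot_def by (rule member_le_sum) (use True in auto)
      with f have "(f j)\<^sup>2 \<le> 1" by (simp add: power2_eq_square)
      then show ?thesis by (simp add: abs_square_le_1 abs_le_iff)
    qed (use f in auto)
    then show "f \<in> ?B" by auto
  qed
  ultimately show ?thesis
    using compact_Int_closed[of ?B ?S] by (simp only: Int_absorb1)
qed

text \<open>A continuous form attains its maximum on the compact unit sphere, and homogeneity
  carries the bound over to every \<open>f\<close>. The hypothesis \<open>p > 0\<close> keeps the
  sphere nonempty.\<close>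

lemma cov_form_maximiser:
  assumes "p > 0"
  obtains w where "dot p w w = 1"
    "\<And>f. cov_form n p x f f \<le> cov_form n p x w w * dot p f f"
proof -
  let ?S = "{f :: nat \<Rightarrow> real. (\<forall>j\<ge>p. f j = 0) \<and> dot p f f = 1}"
  let ?d = "\<lambda>k::nat. if k = 0 then 1 else (0::real)"
  have "dot p ?d ?d = 1" using dot_delta[OF assms, of ?d] by simp
  then have "?d \<in> ?S" using assms by simp
  then have ne: "?S \<noteq> {}" unfolding ex_in_conv[symmetric] by (rule exI[where x = ?d])
  have "continuous_on UNIV (\<lambda>f. cov_form n p x f f)"
    unfolding cov_form_def dot_def divide_inverse
    by (intro continuous_intros continuous_on_product_coordinates)
  then have cont: "continuous_on ?S (\<lambda>f. cov_form n p x f f)"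
    by (rule continuous_on_subset) simp
  from continuous_attains_sup[OF compact_unit_sphere ne cont]
  obtain w where w: "w \<in> ?S" "\<forall>f\<in>?S. cov_form n p x f f \<le> cov_form n p x w w"
    by (rule bexE)
  show ?thesis
  proof (rule that)
    show "dot p w w = 1" using w(1) by simp
    fix f
    define s where "s = dot p f f"
    show "cov_form n p x f f \<le> cov_form n p x w w * dot p f f"
    proof (cases "s = 0")
      case True
      then have "f j = 0" if "j < p" for j
        using that by (auto simp: s_def dot_def sum_nonneg_eq_0_iff)
      then have "dot p (x i) f = 0" for i
        by (simp add: dot_def)
      then show ?thesis using True by (simp add: cov_form_def s_def)
    next
      case False
      then have s: "s > 0" by (simp add: s_def order.not_eq_order_implies_strict)
      define c where "c = 1 / sqrt s"
      have c: "c * c * s = 1" using s by (simp add: c_def)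
      define g where "g = (\<lambda>j. if j < p then c * f j else 0)"
      have d: "dot p h g = c * dot p h f" for h
        by (subst dot_linear_right(3)[symmetric]) (rule dot_cong, auto simp: g_def)
      have "dot p g g = 1"
        using c by (simp add: d dot_commute[of p g f] s_def mult.assoc)
      then have "g \<in> ?S" by (simp add: g_def)
      then have "cov_form n p x g g \<le> cov_form n p x w w" by (rule bspec[OF w(2)])
      moreover have "cov_form n p x g g = c * c * cov_form n p x f f"
        unfolding cov_form_def d by (simp add: sum_distrib_left mult_ac)
      ultimately have "(c * c * cov_form n p x f f) * s \<le> cov_form n p x w w * s"
        using s by (intro mult_right_mono) auto
      also have "(c * c * cov_form n p x f f) * s = (c * c * s) * cov_form n p x f f"
        by (simp add: mult_ac)
      finally show ?thesis
        unfolding c by (simp add: s_def)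
    qed
  qed
qed

text \<open>Near zero the linear term dominates: \<open>t = - s * b\<close> with
  \<open>s * c < 1\<close> makes the expression negative unless \<open>b = 0\<close>.\<close>

lemma linear_coeff_zero_of_quadratic_nonneg:
  fixes b c :: real
  assumes "\<And>t. 2 * t * b + t\<^sup>2 * c \<ge> 0"
  shows "b = 0"
proof (rule ccontr)
  assume b: "b \<noteq> 0"
  define s where "s = 1 / (\<bar>c\<bar> + 1)"
  have s: "s > 0" "s * c < 1" by (auto simp: s_def field_simps)
  have "2 * (- s * b) * b + (- s * b)\<^sup>2 * c = s * b\<^sup>2 * (s * c - 2)"
    by (simp add: power2_eq_square algebra_simps)
  moreover have "\<dots> < 0"
    using b s by (intro mult_pos_neg) auto
  ultimately show False using assms[of "- s * b"] by simp
qed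

text \<open>The nonnegative form \<open>l * dot p f f - cov_form n p x f f\<close> vanishes at the
  maximiser \<open>w\<close>, so the first-order condition kills its pairing of \<open>w\<close>
  with every \<open>h\<close>. Coordinate vectors for \<open>h\<close> then give the eigenvector
  equation.\<close>

lemma cov_form_max_eigenvector:
  assumes "p > 0"
  obtains w l where "dot p w w = 1" "\<And>j. j < p \<Longrightarrow> cov_map n p x w j = l * w j"
    "\<And>f. cov_form n p x f f \<le> l * dot p f f"
proof -
  obtain w where w: "dot p w w = 1" "\<And>f. cov_form n p x f f \<le> cov_form n p x w w * dot p f f"
    using cov_form_maximiser[OF assms] by metis
  define l where "l = cov_form n p x w w"
  have eq: "l * dot p w h - cov_form n p x w h = 0" for h
  proof (rule linear_coeff_zero_of_quadratic_nonneg)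
    fix t :: real
    show "2 * t * (l * dot p w h - cov_form n p x w h) + t\<^sup>2 * (l * dot p h h - cov_form n p x h h) \<ge> 0"
      using w(2)[of "\<lambda>j. w j + t * h j"] w(1)
      by (simp add: l_def[symmetric] dot_commute[of p h w] cov_form_commute[of n p x h w]
          power2_eq_square algebra_simps)
  qed
  have "cov_map n p x w j = l * w j" if "j < p" for j
  proof -
    let ?d = "\<lambda>k. if k = j then 1 else (0::real)"
    have "cov_map n p x w j = dot p ?d (cov_map n p x w)"
      using that by (simp add: dot_delta dot_commute[of p ?d])
    also have "\<dots> = l * dot p w ?d"
      using eq[of ?d] by (simp add: dot_cov_map cov_form_commute[of n p x w])
    finally show ?thesis using that by (simp add: dot_delta)
  qed
  with w show ?thesis by (intro that[of w l]) (auto simp: l_def)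
qed

section \<open>Translation between matrices and coordinate functions\<close>

lemma scalar_prod_eq_dot:
  assumes "w \<in> carrier_vec p"
  shows "u \<bullet> w = dot p (vec_index u) (vec_index w)"
  using assms by (auto simp: scalar_prod_def dot_def atLeast0LessThan)

lemma sample_cov_mult_vec:
  assumes "w \<in> carrier_vec p"
  shows "sample_cov n p x *\<^sub>v w = vec p (cov_map n p x (vec_index w))"
proof (rule eq_vecI)
  fix j assume "j < dim_vec (vec p (cov_map n p x (vec_index w)))"
  then have j: "j < p" by simp
  have "(sample_cov n p x *\<^sub>v w) $ j = (\<Sum>k<p. (\<Sum>i<n. x i j * x i k) / real n * w $ k)"
    using assms j by (simp add: sample_cov_def scalar_prod_def atLeast0LessThan)
  also have "\<dots> = (\<Sum>k<p. \<Sum>i<n. x i j * x i k * w $ k) / real n"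
    by (simp add: sum_divide_distrib sum_distrib_right)
  also have "\<dots> = (\<Sum>i<n. \<Sum>k<p. x i j * x i k * w $ k) / real n"
    by (subst sum.swap) simp
  also have "\<dots> = cov_map n p x (vec_index w) j"
    by (simp add: cov_map_def dot_def sum_distrib_left sum_distrib_right mult_ac)
  finally show "(sample_cov n p x *\<^sub>v w) $ j = vec p (cov_map n p x (vec_index w)) $ j"
    using j by simp
qed (simp add: sample_cov_def)

text \<open>The largest eigenvalue also bounds the quadratic form: the maximiser \<open>w\<close>
  yields an eigenvalue \<open>m\<close> that dominates the form, and maximality of \<open>l\<close>
  gives \<open>m \<le> l\<close>.\<close>

lemma top_unit_eigenvectorD:
  assumes "top_unit_eigenvector (sample_cov n p x) u"
  obtains l where "u \<in> carrier_vec p" "dot p (vec_index u) (vec_index u) = 1"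
    "\<And>j. j < p \<Longrightarrow> cov_map n p x (vec_index u) j = l * u $ j"
    "\<And>f. cov_form n p x f f \<le> l * dot p f f"
proof -
  let ?A = "sample_cov n p x"
  have dim: "dim_row ?A = p" by (simp add: sample_cov_def)
  obtain l where uu: "u \<bullet> u = 1" and l: "eigenvector ?A u l"
    and top: "\<And>l'. eigenvalue ?A l' \<Longrightarrow> l' \<le> l"
    using assms unfolding top_unit_eigenvector_def by blast
  have u: "u \<in> carrier_vec p" "?A *\<^sub>v u = l \<cdot>\<^sub>v u"
    using l by (auto simp: eigenvector_def dim)
  \<comment> \<open>In dimension zero the scalar square of \<open>u\<close> would be zero, not
    one.\<close>
  have "p > 0"
    using u(1) uu by (cases p) (auto simp: scalar_prod_def)
  then obtain w m where w: "dot p w w = 1" "\<And>j. j < p \<Longrightarrow> cov_map n p x w j = m * w j"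
    "\<And>f. cov_form n p x f f \<le> m * dot p f f"
    using cov_form_max_eigenvector by metis
  have ww: "dot p h (vec_index (vec p w)) = dot p h w" for h
    by (rule dot_cong) auto
  have "vec p w \<noteq> 0\<^sub>v p"
  proof
    assume z: "vec p w = 0\<^sub>v p"
    have "w j = 0" if "j < p" for j
      using arg_cong[OF z, of "\<lambda>v. v $ j"] that by simp
    then have "dot p w w = 0" by (simp add: dot_def)
    with w(1) show False by simp
  qed
  moreover have "cov_map n p x (vec_index (vec p w)) j = m * w j" if "j < p" for j
    using w(2)[OF that] by (simp add: cov_map_def ww)
  then have "?A *\<^sub>v vec p w = m \<cdot>\<^sub>v vec p w"
    by (subst sample_cov_mult_vec) auto
  ultimately have "eigenvalue ?A m"
    unfolding eigenvalue_def eigenvector_def by (intro exI[of _ "vec p w"]) (auto simp: dim)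
  then have "m \<le> l" by (rule top)
  show ?thesis
  proof (rule that)
    show "u \<in> carrier_vec p" by fact
    show "dot p (vec_index u) (vec_index u) = 1" using uu scalar_prod_eq_dot[OF u(1)] by simp
    show "cov_map n p x (vec_index u) j = l * u $ j" if "j < p" for j
      using arg_cong[OF u(2), of "\<lambda>v. v $ j"] that u(1) by (simp add: sample_cov_mult_vec)
    show "cov_form n p x f f \<le> l * dot p f f" for f
      using w(3)[of f] mult_right_mono[OF \<open>m \<le> l\<close> dot_self_nonneg[of p f]] by linarith
  qed
qed

section \<open>The angle between an eigenvector and the spike\<close>

definition cov_residual :: "nat \<Rightarrow> nat \<Rightarrow> (nat \<Rightarrow> nat \<Rightarrow> real) \<Rightarrow> (nat \<Rightarrow> real) \<Rightarrow> nat \<Rightarrow> real" where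
  "cov_residual n p x e j = cov_map n p x e j - cov_form n p x e e * e j"

text \<open>Decompose \<open>u = t * e + y\<close> with \<open>y\<close> orthogonal to
  \<open>e\<close> and of norm \<open>s\<close>, the sine of the angle. The eigenvalue equation
  tested against \<open>e\<close> and against the residual gives two inequalities; eliminating
  \<open>l\<close> leaves \<open>R \<le> 8 * (a * s)\<close> whenever
  \<open>s \<le> 1/4\<close>.\<close>

lemma sin_eigenvector_lower_bound:
  assumes uu: "dot p u u = 1" and ee: "dot p e e = 1"
    and eig: "\<And>j. j < p \<Longrightarrow> cov_map n p x u j = l * u j"
    and top: "\<And>f. cov_form n p x f f \<le> l * dot p f f"
    and r: "d\<^sup>2 \<le> dot p (cov_residual n p x e) (cov_residual n p x e)" "d \<ge> 0"
    and a: "cov_form n p x e e \<le> K" "K > 0"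
  shows "min (1/4) (d / (8 * K)) \<le> sqrt (1 - (dot p u e)\<^sup>2)"
proof -
  define t where "t = dot p u e"
  define a where "a = cov_form n p x e e"
  define r where "r = cov_residual n p x e"
  define y where "y = (\<lambda>j. u j - t * e j)"
  define R where "R = sqrt (dot p r r)"
  define s where "s = sqrt (1 - t\<^sup>2)"
  have l0: "l \<ge> 0" using top[of u] cov_form_self_nonneg[of n p x u] uu by (simp del: cov_form_self_nonneg)
  have a0: "a \<ge> 0" by (simp add: a_def)
  have t1: "t\<^sup>2 \<le> 1" using dot_Cauchy_Schwarz[of p u e] uu ee by (simp add: t_def)
  have yy: "dot p y y = s\<^sup>2"
    using t1 uu ee
    by (simp add: y_def s_def dot_commute[of p e u] t_def[symmetric] power2_eq_square algebra_simps)
  have s0: "s \<ge> 0" and R0: "R \<ge> 0" using t1 by (auto simp: s_def R_def)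
  have rr: "dot p r r = R\<^sup>2" by (simp add: R_def)
  have rf: "dot p f r = cov_form n p x f e - a * dot p f e" for f
    unfolding r_def cov_residual_def by (simp add: a_def dot_cov_map)
  have re: "dot p e r = 0" using rf[of e] ee by (simp add: a_def)
  have eig': "cov_form n p x f u = l * dot p f u" for f
    unfolding dot_cov_map[symmetric]
    by (subst dot_linear_right(3)[symmetric]) (rule dot_cong, auto simp: eig)
  have ry: "dot p r y = dot p r u"
    using re by (simp add: y_def dot_commute[of p r e])
  \<comment> \<open>Evaluate \<open>e^T S u\<close> in two ways: by the eigenvector equation, and by
    the splitting \<open>S e = a e + r\<close>.\<close>
  have 1: "l * t = a * t + dot p r y"
  proof -
    have "dot p r y = cov_form n p x u e - a * t"
      using rf[of u] unfolding ry dot_commute[of p r u] t_def .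
    also have "cov_form n p x u e = l * t"
      using eig'[of e] unfolding cov_form_commute[of n p x e u] dot_commute[of p e u] t_def .
    finally show ?thesis by simp
  qed
  have re': "cov_form n p x r e = R\<^sup>2"
    using rf[of r] re by (simp add: rr dot_commute[of p r e])
  \<comment> \<open>Evaluate \<open>r^T S u\<close> in two ways, expanding
    \<open>u = t e + y\<close> and using \<open>r^T S e = R^2\<close> from
    \<open>re'\<close>.\<close>
  have 2: "t * R\<^sup>2 = l * dot p r y - cov_form n p x r y"
    using eig'[of r] ry by (simp add: y_def re' algebra_simps)
  have cs: "\<bar>dot p r y\<bar> \<le> R * s"
    using dot_Cauchy_Schwarz[of p r y] R0 s0 unfolding rr yy
    by (metis abs_le_square_iff abs_of_nonneg mult_nonneg_nonneg power_mult_distrib)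
  have "(cov_form n p x r y)\<^sup>2 \<le> (l * R\<^sup>2) * (l * s\<^sup>2)"
    using cov_form_Cauchy_Schwarz[of n p x r y] mult_mono[OF top[of r] top[of y]] l0
    unfolding rr yy by (simp add: order_trans)
  also have "\<dots> = (l * (R * s))\<^sup>2" by (simp add: power2_eq_square)
  finally have cs2: "\<bar>cov_form n p x r y\<bar> \<le> l * (R * s)"
    using l0 R0 s0 by (metis abs_le_square_iff abs_of_nonneg mult_nonneg_nonneg)
  have "\<bar>t\<bar> * R\<^sup>2 = \<bar>l * dot p r y - cov_form n p x r y\<bar>"
    using 2 by (metis abs_mult abs_power2)
  also have "\<dots> \<le> l * \<bar>dot p r y\<bar> + \<bar>cov_form n p x r y\<bar>"
    using abs_triangle_ineq4[of "l * dot p r y"] l0 by (simp add: abs_mult)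
  also have "\<dots> \<le> 2 * l * (R * s)"
    using cs2 mult_left_mono[OF cs l0] by linarith
  finally have 3: "\<bar>t\<bar> * R\<^sup>2 \<le> 2 * l * s * R" by (simp add: mult_ac)
  have 3: "\<bar>t\<bar> * R \<le> 2 * l * s"
  proof (cases "R = 0")
    case False
    then have "R > 0" using R0 by simp
    then show ?thesis using 3 by (simp add: power2_eq_square mult.assoc[symmetric])
  qed (use l0 s0 in simp)
  have "l * \<bar>t\<bar> = \<bar>a * t + dot p r y\<bar>"
    using 1 l0 by (metis abs_mult abs_of_nonneg)
  also have "\<dots> \<le> a * \<bar>t\<bar> + R * s"
    using abs_triangle_ineq[of "a * t" "dot p r y"] cs a0 by (simp add: abs_mult)
  finally have 4: "l * \<bar>t\<bar> \<le> a * \<bar>t\<bar> + R * s" .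
  have dR: "d \<le> R"
    using assms(5,6) unfolding R_def r_def by (simp add: real_le_rsqrt)
  \<comment> \<open>At a small angle \<open>\<bar>t\<bar>\<close> is at least \<open>1/2\<close>, so
    dividing by it costs only a factor 2. At a larger angle the term \<open>1/4\<close> of the
    minimum already suffices.\<close>
  have "d \<le> 8 * K * s" if s4: "s \<le> 1/4"
  proof -
    have "s\<^sup>2 \<le> (1/4)\<^sup>2" using s4 s0 by (intro power_mono)
    then have s16: "s\<^sup>2 \<le> 1/16" by (simp add: power2_eq_square)
    then have "(1/2)\<^sup>2 \<le> \<bar>t\<bar>\<^sup>2" using t1 by (simp add: s_def power2_eq_square)
    then have t: "1/2 \<le> \<bar>t\<bar>" by (rule power2_le_imp_le) simp
    have "R / 2 \<le> 2 * l * s" using 3 mult_right_mono[OF t R0] by simp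
    have "(l - a) * \<bar>t\<bar> \<le> R * s" using 4 by (simp add: algebra_simps)
    have "l \<le> a + 2 * (R * s)"
    proof (cases "l \<le> a")
      case False
      then have "(l - a) * (1/2) \<le> (l - a) * \<bar>t\<bar>" using t by (intro mult_left_mono) auto
      with \<open>(l - a) * \<bar>t\<bar> \<le> R * s\<close> show ?thesis by simp
    qed (use R0 s0 in \<open>auto intro: add_increasing2\<close>)
    \<comment> \<open>Multiplying by \<open>s\<close> turns the error \<open>2 * (R * s)\<close>
      into one of order \<open>s^2\<close>, small enough for \<open>s \<le> 1/4\<close> to be
      absorbed into \<open>R / 2\<close>.\<close>
    then have "l * s \<le> (a + 2 * (R * s)) * s" using s0 by (intro mult_right_mono)
    also have "\<dots> = a * s + 2 * R * s\<^sup>2" by (simp add: power2_eq_square algebra_simps)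
    also have "\<dots> \<le> a * s + 2 * R * (1/16)" using s16 R0 by (intro add_left_mono mult_left_mono) auto
    finally have "R \<le> 8 * (a * s)" using \<open>R / 2 \<le> 2 * l * s\<close> by simp
    moreover have "a * s \<le> K * s" using a(1) s0 unfolding a_def by (intro mult_right_mono) auto
    ultimately show ?thesis using dR by simp
  qed
  then have "s \<le> 1/4 \<Longrightarrow> d / (8 * K) \<le> s" using a(2) by (simp add: field_simps)
  then show ?thesis unfolding s_def t_def by linarith
qed

section \<open>The residual in the single component model\<close>

lemma dot_spiked_row:
  assumes "dot p e e = 1"
  shows "dot p (\<lambda>j. b * (r * e j) + s * y j) e = b * r + s * dot p y e"
  using assms by simp

text \<open>Subtracting the component along \<open>e\<close> cancels the spike. What remains are the
  noise rows projected orthogonally to \<open>e\<close>, weighted by the components of the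
  observations along \<open>e\<close>.\<close>

lemma cov_residual_spiked:
  assumes unit: "dot p e e = 1"
  shows "cov_residual n p (\<lambda>i j. b i * (r * e j) + s * y i j) e j =
    s / real n * (\<Sum>i<n. (b i * r + s * dot p (y i) e) * (y i j - dot p (y i) e * e j))"
proof -
  have "cov_residual n p (\<lambda>i j. b i * (r * e j) + s * y i j) e j =
    (\<Sum>i<n. (b i * r + s * dot p (y i) e) * (b i * (r * e j) + s * y i j)
      - (b i * r + s * dot p (y i) e) * (b i * r + s * dot p (y i) e) * e j) / real n"
    unfolding cov_residual_def cov_map_def cov_form_def dot_spiked_row[OF unit]
    by (simp add: sum_subtractf diff_divide_distrib sum_distrib_right)
  also have "\<dots> = (\<Sum>i<n. s * ((b i * r + s * dot p (y i) e) * (y i j - dot p (y i) e * e j))) / real n"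
    by (intro arg_cong2[where f = "(/)"] sum.cong) (auto simp: algebra_simps)
  finally show ?thesis unfolding sum_distrib_left[symmetric] by simp
qed

text \<open>The noise-noise part of the residual is even in \<open>b\<close> and the signal-noise
  part is odd, so the difference of the two residuals isolates twice the latter. The squared
  difference is at most twice the sum of the squares.\<close>

lemma cov_residual_spiked_flip:
  fixes y :: "nat \<Rightarrow> nat \<Rightarrow> real" and n p :: nat and r s :: real
  assumes unit: "dot p e e = 1"
  defines "R \<equiv> \<lambda>b. cov_residual n p (\<lambda>i j. b i * (r * e j) + s * y i j) e"
  shows "2 * (s * r / real n)\<^sup>2 * (\<Sum>j<p. ((\<Sum>i<n. b i * y i j) - (\<Sum>i<n. b i * dot p (y i) e) * e j)\<^sup>2)
    \<le> dot p (R b) (R b) + dot p (R (\<lambda>i. - b i)) (R (\<lambda>i. - b i))"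
proof -
  define w where "w j = (\<Sum>i<n. b i * y i j) - (\<Sum>i<n. b i * dot p (y i) e) * e j" for j
  have "R b j - R (\<lambda>i. - b i) j = 2 * (s * r / real n) * w j" for j
  proof -
    have "R b j - R (\<lambda>i. - b i) j = s / real n * (\<Sum>i<n. 2 * r * (b i * y i j - b i * dot p (y i) e * e j))"
      unfolding R_def cov_residual_spiked[OF unit] right_diff_distrib[symmetric] sum_subtractf[symmetric]
      by (intro arg_cong2[where f = "(*)"] sum.cong) (auto simp: algebra_simps)
    also have "(\<Sum>i<n. 2 * r * (b i * y i j - b i * dot p (y i) e * e j)) = 2 * r * w j"
      unfolding w_def by (simp add: sum_distrib_left sum_distrib_right sum_subtractf right_diff_distrib)
    finally show ?thesis by simp
  qed
  then have "4 * (s * r / real n)\<^sup>2 * (w j)\<^sup>2 \<le> 2 * (R b j * R b j + R (\<lambda>i. - b i) j * R (\<lambda>i. - b i) j)" for j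
  proof -
    have "4 * (s * r / real n)\<^sup>2 * (w j)\<^sup>2 = (R b j - R (\<lambda>i. - b i) j)\<^sup>2"
      unfolding \<open>R b j - R (\<lambda>i. - b i) j = 2 * (s * r / real n) * w j\<close> by (simp only: power_mult_distrib) simp
    also have "\<dots> \<le> 2 * (R b j * R b j + R (\<lambda>i. - b i) j * R (\<lambda>i. - b i) j)"
      using zero_le_power2[of "R b j + R (\<lambda>i. - b i) j"]
      unfolding power2_eq_square by (simp add: algebra_simps)
    finally show ?thesis .
  qed
  then have "(\<Sum>j<p. 4 * (s * r / real n)\<^sup>2 * (w j)\<^sup>2)
      \<le> (\<Sum>j<p. 2 * (R b j * R b j + R (\<lambda>i. - b i) j * R (\<lambda>i. - b i) j))"
    by (intro sum_mono)
  then have "4 * (s * r / real n)\<^sup>2 * (\<Sum>j<p. (w j)\<^sup>2)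
      \<le> 2 * (dot p (R b) (R b) + dot p (R (\<lambda>i. - b i)) (R (\<lambda>i. - b i)))"
    unfolding sum_distrib_left[symmetric] sum.distrib dot_def .
  then show ?thesis
    unfolding w_def[symmetric] by simp
qed

section \<open>Moments of independent sums\<close>

context prob_space
begin

lemma indep_var_power_mult:
  fixes X Y :: "'a \<Rightarrow> real"
  assumes ind: "indep_var borel X borel Y"
    and int: "integrable M (\<lambda>\<omega>. X \<omega> ^ a)" "integrable M (\<lambda>\<omega>. Y \<omega> ^ b)"
  shows "integrable M (\<lambda>\<omega>. X \<omega> ^ a * Y \<omega> ^ b)"
    and "expectation (\<lambda>\<omega>. X \<omega> ^ a * Y \<omega> ^ b) = expectation (\<lambda>\<omega>. X \<omega> ^ a) * expectation (\<lambda>\<omega>. Y \<omega> ^ b)"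
proof -
  have "indep_var borel ((\<lambda>x. x ^ a) \<circ> X) borel ((\<lambda>x. x ^ b) \<circ> Y)"
    by (rule indep_var_compose[OF ind]) measurable
  then have *: "indep_var borel (\<lambda>\<omega>. X \<omega> ^ a) borel (\<lambda>\<omega>. Y \<omega> ^ b)"
    by (simp add: comp_def)
  show "integrable M (\<lambda>\<omega>. X \<omega> ^ a * Y \<omega> ^ b)"
    by (rule indep_var_integrable[OF * int])
  show "expectation (\<lambda>\<omega>. X \<omega> ^ a * Y \<omega> ^ b) = expectation (\<lambda>\<omega>. X \<omega> ^ a) * expectation (\<lambda>\<omega>. Y \<omega> ^ b)"
    by (rule indep_var_lebesgue_integral[OF * int])
qed

text \<open>Induction on the index set, splitting off one summand that is independent of the partial
  sum. The claims travel together because the fourth-moment step uses the lower moments of the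
  partial sum; mixed terms with a factor of first power vanish by centring.\<close>

lemma indep_sum_moments:
  fixes X :: "'i \<Rightarrow> 'a \<Rightarrow> real"
  assumes "finite I" "indep_vars (\<lambda>_. borel) X I"
    and "\<And>i k. i \<in> I \<Longrightarrow> integrable M (\<lambda>\<omega>. X i \<omega> ^ k)"
    and "\<And>i. i \<in> I \<Longrightarrow> expectation (X i) = 0"
  shows "(\<forall>k. integrable M (\<lambda>\<omega>. (\<Sum>i\<in>I. X i \<omega>) ^ k)) \<and>
    expectation (\<lambda>\<omega>. \<Sum>i\<in>I. X i \<omega>) = 0 \<and>
    expectation (\<lambda>\<omega>. (\<Sum>i\<in>I. X i \<omega>)\<^sup>2) = (\<Sum>i\<in>I. expectation (\<lambda>\<omega>. (X i \<omega>)\<^sup>2)) \<and>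
    expectation (\<lambda>\<omega>. (\<Sum>i\<in>I. X i \<omega>) ^ 4) \<le>
      (\<Sum>i\<in>I. expectation (\<lambda>\<omega>. X i \<omega> ^ 4)) + 3 * (\<Sum>i\<in>I. expectation (\<lambda>\<omega>. (X i \<omega>)\<^sup>2))\<^sup>2"
  using assms
proof (induction I rule: finite_induct)
  case empty
  show ?case by simp
next
  case (insert i I)
  define S where "S = (\<lambda>\<omega>. \<Sum>i\<in>I. X i \<omega>)"
  define m2 where "m2 = (\<Sum>i\<in>I. expectation (\<lambda>\<omega>. (X i \<omega>)\<^sup>2))"
  define m4 where "m4 = (\<Sum>i\<in>I. expectation (\<lambda>\<omega>. X i \<omega> ^ 4))"
  have "indep_vars (\<lambda>_. borel) X I"
    by (rule indep_vars_subset[OF insert.prems(1)]) auto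
  from insert.IH[OF this] insert.prems
  have S: "\<And>k. integrable M (\<lambda>\<omega>. S \<omega> ^ k)" "expectation S = 0"
    "expectation (\<lambda>\<omega>. (S \<omega>)\<^sup>2) = m2" "expectation (\<lambda>\<omega>. S \<omega> ^ 4) \<le> m4 + 3 * m2\<^sup>2"
    by (auto simp: S_def m2_def m4_def)
  have X: "\<And>k. integrable M (\<lambda>\<omega>. X i \<omega> ^ k)" "expectation (X i) = 0"
    using insert.prems by auto
  have ind: "indep_var borel (X i) borel S"
    unfolding S_def by (rule indep_vars_sum) (use insert in auto)
  note P = indep_var_power_mult[OF ind X(1) S(1)]
  have int: "integrable M (\<lambda>\<omega>. (X i \<omega> + S \<omega>) ^ k)" for k
    unfolding binomial_ring mult.assoc
    by (intro Bochner_Integration.integrable_sum integrable_mult_right P)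
  have e1: "expectation (\<lambda>\<omega>. X i \<omega> + S \<omega>) = 0"
    using X(1)[of 1] S(1)[of 1] X(2) S(2) by simp
  have e2: "expectation (\<lambda>\<omega>. (X i \<omega> + S \<omega>)\<^sup>2) = expectation (\<lambda>\<omega>. (X i \<omega>)\<^sup>2) + m2"
  proof -
    \<comment> \<open>The exponents 1 are kept explicit so that the mixed-moment rules
      \<open>P\<close> match.\<close>
    have "(X i \<omega> + S \<omega>)\<^sup>2 = (X i \<omega>)\<^sup>2 + 2 * (X i \<omega> ^ 1 * S \<omega> ^ 1) + (S \<omega>)\<^sup>2" for \<omega>
      by (simp add: power2_sum)
    then have "expectation (\<lambda>\<omega>. (X i \<omega> + S \<omega>)\<^sup>2) = expectation (\<lambda>\<omega>. (X i \<omega>)\<^sup>2)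
        + 2 * expectation (\<lambda>\<omega>. X i \<omega> ^ 1 * S \<omega> ^ 1) + expectation (\<lambda>\<omega>. (S \<omega>)\<^sup>2)"
      using X(1)[of 2] S(1)[of 2] P(1)[of 1 1] by simp
    also have "expectation (\<lambda>\<omega>. X i \<omega> ^ 1 * S \<omega> ^ 1) = 0"
      unfolding P(2) by (simp add: X(2))
    finally show ?thesis using S(3) by simp
  qed
  have e4: "expectation (\<lambda>\<omega>. (X i \<omega> + S \<omega>) ^ 4) \<le>
      expectation (\<lambda>\<omega>. X i \<omega> ^ 4) + m4 + 3 * (expectation (\<lambda>\<omega>. (X i \<omega>)\<^sup>2) + m2)\<^sup>2"
  proof -
    have "(X i \<omega> + S \<omega>) ^ 4 = X i \<omega> ^ 4 + 4 * (X i \<omega> ^ 3 * S \<omega> ^ 1)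
        + 6 * (X i \<omega> ^ 2 * S \<omega> ^ 2) + 4 * (X i \<omega> ^ 1 * S \<omega> ^ 3) + S \<omega> ^ 4" for \<omega>
      by (simp add: power4_eq_xxxx power3_eq_cube power2_eq_square algebra_simps)
    then have "expectation (\<lambda>\<omega>. (X i \<omega> + S \<omega>) ^ 4) = expectation (\<lambda>\<omega>. X i \<omega> ^ 4)
        + 4 * expectation (\<lambda>\<omega>. X i \<omega> ^ 3 * S \<omega> ^ 1) + 6 * expectation (\<lambda>\<omega>. X i \<omega> ^ 2 * S \<omega> ^ 2)
        + 4 * expectation (\<lambda>\<omega>. X i \<omega> ^ 1 * S \<omega> ^ 3) + expectation (\<lambda>\<omega>. S \<omega> ^ 4)"
      using X(1)[of 4] S(1)[of 4] P(1)[of 3 1] P(1)[of 2 2] P(1)[of 1 3] by simp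
    also have "expectation (\<lambda>\<omega>. X i \<omega> ^ 3 * S \<omega> ^ 1) = 0"
      unfolding P(2) by (simp add: S(2))
    also have "expectation (\<lambda>\<omega>. X i \<omega> ^ 1 * S \<omega> ^ 3) = 0"
      unfolding P(2) by (simp add: X(2))
    also have "expectation (\<lambda>\<omega>. X i \<omega> ^ 2 * S \<omega> ^ 2) = expectation (\<lambda>\<omega>. (X i \<omega>)\<^sup>2) * m2"
      unfolding P(2) S(3) ..
    \<comment> \<open>With \<open>x\<close> the second moment of \<open>X i\<close>, the term
      \<open>3 * (x + m2)^2\<close> supplies the cross term \<open>6 * x * m2\<close>, and its
      surplus \<open>3 * x^2\<close> is dropped.\<close>
    finally show ?thesis
      by (simp add: power2_sum)
        (use S(4) zero_le_power2[of "expectation (\<lambda>\<omega>. (X i \<omega>)\<^sup>2)"] in linarith)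
  qed
  have "(\<Sum>i\<in>insert i I. X i \<omega>) = X i \<omega> + S \<omega>" for \<omega>
    using insert.hyps by (simp add: S_def)
  then show ?case
    using insert.hyps int e1 e2 e4 by (simp add: m2_def m4_def)
qed

text \<open>Integrate the pointwise bound \<open>pt\<close>: off the event \<open>X\<close> is below
  \<open>m / 2\<close>, and on it \<open>X \<le> X^2 / (4 * C * m) + C * m\<close> by completing the
  square. This gives \<open>m \<le> m / 2 + m / 4 + C * m * P\<close> for the probability
  \<open>P\<close> of the event.\<close>

lemma paley_zygmund:
  fixes X :: "'a \<Rightarrow> real"
  assumes int: "integrable M X" "integrable M (\<lambda>\<omega>. (X \<omega>)\<^sup>2)"
    and m: "expectation X = m" "m > 0"
    and C: "expectation (\<lambda>\<omega>. (X \<omega>)\<^sup>2) \<le> C * m\<^sup>2" "C > 0"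
  shows "prob {\<omega> \<in> space M. m / 2 \<le> X \<omega>} \<ge> 1 / (4 * C)"
proof -
  let ?B = "{\<omega> \<in> space M. m / 2 \<le> X \<omega>}"
  have B: "?B \<in> events" using borel_measurable_integrable[OF int(1)] by measurable
  have pt: "X \<omega> \<le> m / 2 + (X \<omega>)\<^sup>2 / (4 * C * m) + C * m * indicator ?B \<omega>" if "\<omega> \<in> space M" for \<omega>
  proof (cases "m / 2 \<le> X \<omega>")
    case True
    have "0 \<le> (X \<omega> - 2 * C * m)\<^sup>2 / (4 * C * m)" using m C by simp
    also have "\<dots> = (X \<omega>)\<^sup>2 / (4 * C * m) + C * m - X \<omega>"
      using m C by (simp add: field_simps power2_eq_square)
    finally show ?thesis using True that m by simp
  next
    case False
    then show ?thesis using m C by (simp add: add_increasing2)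
  qed
  have iB: "integrable M (indicator ?B :: 'a \<Rightarrow> real)"
    by (rule integrable_real_indicator[OF B]) (simp add: less_top[symmetric])
  have iX: "integrable M (\<lambda>\<omega>. (X \<omega>)\<^sup>2 / (4 * C * m))"
    by (rule integrable_divide[OF int(2)])
  have intI: "integrable M (\<lambda>\<omega>. m / 2 + (X \<omega>)\<^sup>2 / (4 * C * m) + C * m * indicator ?B \<omega>)"
    by (intro Bochner_Integration.integrable_add integrable_mult_right iX iB integrable_const)
  have "m \<le> expectation (\<lambda>\<omega>. m / 2 + (X \<omega>)\<^sup>2 / (4 * C * m) + C * m * indicator ?B \<omega>)"
    using integral_mono[OF int(1) intI pt] unfolding m(1) .
  also have "\<dots> = m / 2 + expectation (\<lambda>\<omega>. (X \<omega>)\<^sup>2) / (4 * C * m) + C * m * prob ?B"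
    using B iB iX by (simp add: prob_space)
  also have "expectation (\<lambda>\<omega>. (X \<omega>)\<^sup>2) / (4 * C * m) \<le> C * m\<^sup>2 / (4 * C * m)"
    using C m by (intro divide_right_mono) auto
  also have "C * m\<^sup>2 / (4 * C * m) = m / 4"
    using C m by (simp add: power2_eq_square)
  finally have "m * (1 / 4) \<le> C * m * prob ?B" by linarith
  also have "\<dots> = m * (C * prob ?B)" by (simp only: mult_ac)
  finally have "m * (1 / 4) \<le> m * (C * prob ?B)" .
  then have "1 / 4 \<le> C * prob ?B" using m by (simp only: mult_le_cancel_left_pos)
  then show ?thesis using C by (simp add: field_simps)
qed

lemma std_normal_moments:
  assumes D: "distributed M lborel X std_normal_density"
  shows "integrable M (\<lambda>\<omega>. X \<omega> ^ k)" "expectation X = 0"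
    "expectation (\<lambda>\<omega>. (X \<omega>)\<^sup>2) = 1" "expectation (\<lambda>\<omega>. X \<omega> ^ 4) = 3"
proof -
  have E: "expectation (\<lambda>\<omega>. X \<omega> ^ k) = (\<integral>x. std_normal_density x * x ^ k \<partial>lborel)" for k
    by (rule distributed_integral[OF D, symmetric]) auto
  show "integrable M (\<lambda>\<omega>. X \<omega> ^ k)"
    using distributed_integrable[OF D, of "\<lambda>x. x ^ k"] integrable_std_normal_moment by simp
  show "expectation X = 0"
    using E[of 1] integral_std_normal_moment_odd[of 0] by simp
  show "expectation (\<lambda>\<omega>. (X \<omega>)\<^sup>2) = 1"
    using E[of 2] integral_std_normal_moment_even[of 1] by simp
  show "expectation (\<lambda>\<omega>. X \<omega> ^ 4) = 3"
    using E[of 4] integral_std_normal_moment_even[of 2] by (simp add: fact_numeral)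
qed

lemma std_normal_distr_uminus:
  assumes D: "distributed M lborel X std_normal_density"
  shows "distr M borel (\<lambda>\<omega>. - X \<omega>) = distr M borel X"
proof -
  have "distributed M lborel (\<lambda>\<omega>. 0 + (-1) * X \<omega>) (normal_density (0 + (-1) * 0) (\<bar>-1\<bar> * 1))"
    by (rule normal_density_affine[OF D]) auto
  then have D': "distributed M lborel (\<lambda>\<omega>. - X \<omega>) std_normal_density" by simp
  have "distr M borel Y = density lborel std_normal_density"
    if "distributed M lborel Y std_normal_density" for Y
    using distributed_distr_eq_density[OF that] by (simp cong: distr_cong)
  from this[OF D] this[OF D'] show ?thesis by simp
qed

text \<open>Measurable functions of disjoint blocks of independent variables are independent. The
  equation \<open>eq\<close> lets \<open>Z\<close> be given in its natural form, with the block
  restriction confined to \<open>Y\<close>.\<close>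

lemma indep_vars_blocks:
  assumes "indep_vars N X I" "\<And>j. j \<in> L \<Longrightarrow> K j \<subseteq> I" "disjoint_family_on K L"
    and "\<And>j. j \<in> L \<Longrightarrow> Y j \<in> borel_measurable (PiM (K j) N)"
    and eq: "\<And>j \<omega>. j \<in> L \<Longrightarrow> Z j \<omega> = Y j (\<lambda>i\<in>K j. X i \<omega>)"
  shows "indep_vars (\<lambda>_. borel) Z L"
proof -
  have "indep_vars (\<lambda>_. borel) (\<lambda>j \<omega>. Y j (\<lambda>i\<in>K j. X i \<omega>)) L"
    by (rule indep_vars_compose2[OF indep_vars_restrict[OF assms(1-3)] assms(4)])
  then show ?thesis
    by (subst indep_vars_cong[OF refl _ refl, where Y = "\<lambda>j \<omega>. Y j (\<lambda>i\<in>K j. X i \<omega>)"]) (auto simp: eq)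
qed

end

section \<open>The Gaussian model\<close>

text \<open>The model at one fixed \<open>n\<close>, with \<open>e\<close> the unit direction of the
  spike. Indexing by a sum type makes the \<open>v i\<close> and \<open>z i j\<close> one jointly
  independent family; spike length and noise level enter as arguments of later definitions.\<close>

locale gaussian_design = prob_space M for M :: "'a measure" +
  fixes n p :: nat
    and v :: "nat \<Rightarrow> 'a \<Rightarrow> real"
    and z :: "nat \<Rightarrow> nat \<Rightarrow> 'a \<Rightarrow> real"
    and e :: "nat \<Rightarrow> real"
  assumes v_normal: "\<And>i. i < n \<Longrightarrow> distributed M lborel (v i) std_normal_density"
    and z_normal: "\<And>i j. i < n \<Longrightarrow> j < p \<Longrightarrow> distributed M lborel (z i j) std_normal_density"
    and indep: "indep_vars (\<lambda>_. borel) (\<lambda>k. case k of Inl i \<Rightarrow> v i | Inr (i, j) \<Rightarrow> z i j)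
        (Inl ` {..<n} \<union> Inr ` ({..<n} \<times> {..<p}))"
    and unit: "dot p e e = 1"
begin

abbreviation coords :: "(nat + nat \<times> nat) set" where
  "coords \<equiv> Inl ` {..<n} \<union> Inr ` ({..<n} \<times> {..<p})"

abbreviation entry :: "nat + nat \<times> nat \<Rightarrow> 'a \<Rightarrow> real" where
  "entry k \<equiv> (case k of Inl i \<Rightarrow> v i | Inr (i, j) \<Rightarrow> z i j)"

text \<open>\<open>score i\<close> is \<open>z\<^sub>i \<cdot> e\<close>, \<open>col j\<close> is the \<open>j\<close>-th coordinate of \<open>Z\<^sup>T v\<close>, \<open>col_score\<close> is \<open>e \<cdot> Z\<^sup>T v\<close>.\<close>

definition score :: "nat \<Rightarrow> 'a \<Rightarrow> real" where
  "score i \<omega> = (\<Sum>j<p. e j * z i j \<omega>)"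

definition col :: "nat \<Rightarrow> 'a \<Rightarrow> real" where
  "col j \<omega> = (\<Sum>i<n. v i \<omega> * z i j \<omega>)"

definition col_score :: "'a \<Rightarrow> real" where
  "col_score \<omega> = (\<Sum>i<n. v i \<omega> * score i \<omega>)"

lemma v_measurable: "i < n \<Longrightarrow> v i \<in> borel_measurable M"
  using distributed_measurable[OF v_normal] by simp

lemma z_measurable: "i < n \<Longrightarrow> j < p \<Longrightarrow> z i j \<in> borel_measurable M"
  using distributed_measurable[OF z_normal] by simp

lemma score_measurable: "i < n \<Longrightarrow> score i \<in> borel_measurable M"
  unfolding score_def by (intro borel_measurable_sum borel_measurable_times z_measurable) auto

lemma col_measurable: "j < p \<Longrightarrow> col j \<in> borel_measurable M"
  unfolding col_def by (intro borel_measurable_sum borel_measurable_times z_measurable v_measurable) auto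

lemma col_score_measurable: "col_score \<in> borel_measurable M"
  unfolding col_score_def
  by (intro borel_measurable_sum borel_measurable_times score_measurable v_measurable) auto

text \<open>A sum of independent centred variables with variances \<open>e j * e j\<close>, which
  add up to one.\<close>

lemma score_moments:
  assumes i: "i < n"
  shows "integrable M (\<lambda>\<omega>. score i \<omega> ^ k)" "expectation (score i) = 0"
    "expectation (\<lambda>\<omega>. (score i \<omega>)\<^sup>2) = 1"
proof -
  have ind: "indep_vars (\<lambda>_. borel) (\<lambda>j \<omega>. e j * z i j \<omega>) {..<p}"
    by (rule indep_vars_blocks[OF indep, where K = "\<lambda>j. {Inr (i, j)}" and Y = "\<lambda>j f. e j * f (Inr (i, j))"])
      (use i in \<open>auto simp: disjoint_family_on_def\<close>)
  have "integrable M (\<lambda>\<omega>. (e j * z i j \<omega>) ^ k)" if "j \<in> {..<p}" for j k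
    using std_normal_moments(1)[OF z_normal[OF i], of j k] that by (simp add: power_mult_distrib)
  moreover have "expectation (\<lambda>\<omega>. e j * z i j \<omega>) = 0" if "j \<in> {..<p}" for j
    using std_normal_moments(2)[OF z_normal[OF i], of j] that by simp
  ultimately have *: "(\<forall>k. integrable M (\<lambda>\<omega>. score i \<omega> ^ k)) \<and> expectation (score i) = 0 \<and>
    expectation (\<lambda>\<omega>. (score i \<omega>)\<^sup>2) = (\<Sum>j<p. expectation (\<lambda>\<omega>. (e j * z i j \<omega>)\<^sup>2))"
    unfolding score_def using indep_sum_moments[OF finite_lessThan ind] by simp
  then show "integrable M (\<lambda>\<omega>. score i \<omega> ^ k)" "expectation (score i) = 0" by auto
  have "expectation (\<lambda>\<omega>. (e j * z i j \<omega>)\<^sup>2) = e j * e j" if "j \<in> {..<p}" for j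
    using std_normal_moments(3)[OF z_normal[OF i], of j] that
    by (simp add: power_mult_distrib) (simp add: power2_eq_square)
  then show "expectation (\<lambda>\<omega>. (score i \<omega>)\<^sup>2) = 1"
    using * unit by (simp add: dot_def)
qed

text \<open>Stated for a general factor \<open>Y\<close> because it serves both for the noise
  entries \<open>z i j\<close> and for the scores.\<close>

lemma product_moments:
  assumes "i < n" and ind: "indep_var borel (v i) borel Y"
    and Y: "\<And>k. integrable M (\<lambda>\<omega>. Y \<omega> ^ k)" "expectation Y = 0" "expectation (\<lambda>\<omega>. (Y \<omega>)\<^sup>2) = 1"
  shows "integrable M (\<lambda>\<omega>. (v i \<omega> * Y \<omega>) ^ k)" "expectation (\<lambda>\<omega>. v i \<omega> * Y \<omega>) = 0"
    "expectation (\<lambda>\<omega>. (v i \<omega> * Y \<omega>)\<^sup>2) = 1"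
    "expectation (\<lambda>\<omega>. (v i \<omega> * Y \<omega>) ^ 4) = 3 * expectation (\<lambda>\<omega>. Y \<omega> ^ 4)"
proof -
  note V = std_normal_moments[OF v_normal[OF assms(1)]]
  note P = indep_var_power_mult[OF ind V(1) Y(1)]
  show "integrable M (\<lambda>\<omega>. (v i \<omega> * Y \<omega>) ^ k)"
    unfolding power_mult_distrib by (rule P)
  show "expectation (\<lambda>\<omega>. v i \<omega> * Y \<omega>) = 0"
    using P(2)[of 1 1] Y(2) by simp
  show "expectation (\<lambda>\<omega>. (v i \<omega> * Y \<omega>)\<^sup>2) = 1"
    unfolding power_mult_distrib P(2) V(3) Y(3) by simp
  show "expectation (\<lambda>\<omega>. (v i \<omega> * Y \<omega>) ^ 4) = 3 * expectation (\<lambda>\<omega>. Y \<omega> ^ 4)"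
    unfolding power_mult_distrib P(2) V(4) ..
qed

text \<open>The variable \<open>v i\<close> and the noise entries of row \<open>i\<close> occupy
  disjoint coordinates, so any measurable function of the latter is independent of
  \<open>v i\<close>.\<close>

lemma indep_var_v_block:
  assumes "i < n" "J \<subseteq> {..<p}" "f \<in> borel_measurable (PiM (Inr ` ({i} \<times> J)) (\<lambda>_. borel))"
    and "\<And>\<omega>. Y \<omega> = f (\<lambda>k\<in>Inr ` ({i} \<times> J). entry k \<omega>)"
  shows "indep_var borel (v i) borel Y"
proof -
  have "indep_var borel ((\<lambda>g. g (Inl i)) \<circ> (\<lambda>\<omega>. \<lambda>k\<in>{Inl i}. entry k \<omega>))
      borel (f \<circ> (\<lambda>\<omega>. \<lambda>k\<in>Inr ` ({i} \<times> J). entry k \<omega>))"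
    using assms
    by (intro indep_var_compose[OF indep_var_restrict[OF indep]] measurable_component_singleton) auto
  moreover have "(\<lambda>g. g (Inl i)) \<circ> (\<lambda>\<omega>. \<lambda>k\<in>{Inl i}. entry k \<omega>) = v i"
    by (simp add: fun_eq_iff)
  moreover have "f \<circ> (\<lambda>\<omega>. \<lambda>k\<in>Inr ` ({i} \<times> J). entry k \<omega>) = Y"
    by (simp add: fun_eq_iff assms(4))
  ultimately show ?thesis by simp
qed

text \<open>The summands \<open>v i * z i j\<close> are independent over \<open>i\<close>, with
  second moment 1 and fourth moment \<open>3 * 3 = 9\<close>; this gives
  \<open>9 * n + 3 * n^2\<close>, at most \<open>12 * n^2\<close>.\<close>

lemma col_moments:
  assumes j: "j < p"
  shows "integrable M (\<lambda>\<omega>. col j \<omega> ^ k)" "expectation (\<lambda>\<omega>. (col j \<omega>)\<^sup>2) = n"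
    "expectation (\<lambda>\<omega>. col j \<omega> ^ 4) \<le> 12 * (real n)\<^sup>2"
proof -
  have ind: "indep_vars (\<lambda>_. borel) (\<lambda>i \<omega>. v i \<omega> * z i j \<omega>) {..<n}"
    by (rule indep_vars_blocks[OF indep, where K = "\<lambda>i. {Inl i, Inr (i, j)}"
          and Y = "\<lambda>i f. f (Inl i) * f (Inr (i, j))"])
      (use j in \<open>auto simp: disjoint_family_on_def\<close>)
  have "indep_var borel (v i) borel (z i j)" if "i < n" for i
    by (rule indep_var_v_block[where J = "{j}" and f = "\<lambda>f. f (Inr (i, j))"]) (use that j in auto)
  note P = product_moments[OF _ this std_normal_moments(1-3)[OF z_normal[OF _ j]]]
  have P4: "expectation (\<lambda>\<omega>. (v i \<omega> * z i j \<omega>) ^ 4) = 9" if "i < n" for i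
    using P(4)[OF that] std_normal_moments(4)[OF z_normal[OF that j]] that by simp
  have *: "(\<forall>k. integrable M (\<lambda>\<omega>. col j \<omega> ^ k)) \<and>
    expectation (\<lambda>\<omega>. (col j \<omega>)\<^sup>2) = n \<and> expectation (\<lambda>\<omega>. col j \<omega> ^ 4) \<le> n * 9 + 3 * (real n)\<^sup>2"
    unfolding col_def using indep_sum_moments[OF finite_lessThan ind] P P4 by simp
  then show "integrable M (\<lambda>\<omega>. col j \<omega> ^ k)" "expectation (\<lambda>\<omega>. (col j \<omega>)\<^sup>2) = n" by auto
  have "real n \<le> (real n)\<^sup>2" by (cases n) (auto simp: power2_eq_square)
  then show "expectation (\<lambda>\<omega>. col j \<omega> ^ 4) \<le> 12 * (real n)\<^sup>2" using * by linarith
qed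

text \<open>Beyond integrability only the second moment is recorded: \<open>col_score\<close> enters
  \<open>proj_sq\<close> as a subtracted square, which lowers the mean but can be discarded when
  bounding the second moment from above.\<close>

lemma col_score_moments:
  shows "integrable M (\<lambda>\<omega>. col_score \<omega> ^ k)" "expectation (\<lambda>\<omega>. (col_score \<omega>)\<^sup>2) = n"
proof -
  have meas: "(\<lambda>f. \<Sum>j<p. e j * f (Inr (i, j))) \<in> borel_measurable (PiM K (\<lambda>_. borel))"
    if "Inr ` ({i} \<times> {..<p}) \<subseteq> K" for i :: nat and K :: "(nat + nat \<times> nat) set"
    using that by (intro borel_measurable_sum borel_measurable_times measurable_component_singleton) auto
  have ind: "indep_vars (\<lambda>_. borel) (\<lambda>i \<omega>. v i \<omega> * score i \<omega>) {..<n}"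
    by (rule indep_vars_blocks[OF indep, where K = "\<lambda>i. insert (Inl i) (Inr ` ({i} \<times> {..<p}))"
          and Y = "\<lambda>i f. f (Inl i) * (\<Sum>j<p. e j * f (Inr (i, j)))"])
      (auto simp: disjoint_family_on_def score_def intro!: borel_measurable_times meas sum.cong)
  have "indep_var borel (v i) borel (score i)" if "i < n" for i
    by (rule indep_var_v_block[where J = "{..<p}" and f = "\<lambda>f. \<Sum>j<p. e j * f (Inr (i, j))"])
      (use that in \<open>auto simp: score_def intro!: meas sum.cong\<close>)
  note P = product_moments[OF _ this score_moments]
  have *: "(\<forall>k. integrable M (\<lambda>\<omega>. col_score \<omega> ^ k)) \<and> expectation (\<lambda>\<omega>. (col_score \<omega>)\<^sup>2) = n"
    unfolding col_score_def using indep_sum_moments[OF finite_lessThan ind] P by simp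
  then show "integrable M (\<lambda>\<omega>. col_score \<omega> ^ k)" "expectation (\<lambda>\<omega>. (col_score \<omega>)\<^sup>2) = n" by auto
qed

section \<open>The noise projected orthogonally to the spike\<close>

definition proj_sq :: "'a \<Rightarrow> real" where
  "proj_sq \<omega> = (\<Sum>j<p. (col j \<omega> - col_score \<omega> * e j)\<^sup>2)"

text \<open>Pythagoras: \<open>col_score\<close> is the component of the vector of the
  \<open>col j\<close> along the unit vector \<open>e\<close>.\<close>

lemma proj_sq_eq: "proj_sq \<omega> = (\<Sum>j<p. (col j \<omega>)\<^sup>2) - (col_score \<omega>)\<^sup>2"
proof -
  have "col_score \<omega> = (\<Sum>i<n. \<Sum>j<p. v i \<omega> * (e j * z i j \<omega>))"
    by (simp add: col_score_def score_def sum_distrib_left)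
  also have "\<dots> = (\<Sum>j<p. \<Sum>i<n. v i \<omega> * (e j * z i j \<omega>))" by (rule sum.swap)
  also have "\<dots> = (\<Sum>j<p. col j \<omega> * e j)"
    by (simp add: col_def sum_distrib_left sum_distrib_right mult_ac)
  finally have V: "(\<Sum>j<p. col j \<omega> * e j) = col_score \<omega>" ..
  have "proj_sq \<omega> = (\<Sum>j<p. (col j \<omega>)\<^sup>2 - 2 * col_score \<omega> * (col j \<omega> * e j) + (col_score \<omega>)\<^sup>2 * (e j * e j))"
    unfolding proj_sq_def by (rule sum.cong) (auto simp: power2_eq_square algebra_simps)
  also have "\<dots> = (\<Sum>j<p. (col j \<omega>)\<^sup>2) - 2 * col_score \<omega> * (\<Sum>j<p. col j \<omega> * e j)
      + (col_score \<omega>)\<^sup>2 * dot p e e"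
    by (simp add: sum.distrib sum_subtractf sum_distrib_left dot_def)
  finally show ?thesis unfolding V unit by (simp add: power2_eq_square)
qed

lemma proj_sq_measurable: "proj_sq \<in> borel_measurable M"
  unfolding proj_sq_def using col_measurable col_score_measurable
  by (intro borel_measurable_sum borel_measurable_power borel_measurable_diff borel_measurable_times) auto

text \<open>The mean is \<open>n * p - n\<close>. Dropping the subtracted square and applying
  Cauchy-Schwarz reduces the second moment to the fourth moments of the \<open>col j\<close>; the
  constant is \<open>1 / (4 * 48)\<close>.\<close>

lemma proj_sq_lower_bound:
  assumes n: "n > 0" and p: "p \<ge> 2"
  shows "prob {\<omega> \<in> space M. real n * (real p - 1) / 2 \<le> proj_sq \<omega>} \<ge> 1 / 192"
proof -
  have nn: "proj_sq \<omega> \<ge> 0" for \<omega> by (simp add: proj_sq_def sum_nonneg)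
  have int: "integrable M proj_sq"
    unfolding proj_sq_eq[abs_def] using col_moments(1)[of _ 2] col_score_moments(1)[of 2]
    by (intro Bochner_Integration.integrable_diff Bochner_Integration.integrable_sum) auto
  have E: "expectation proj_sq = real n * (real p - 1)"
    unfolding proj_sq_eq[abs_def]
    using col_moments(1)[of _ 2] col_moments(2) col_score_moments(1)[of 2] col_score_moments(2)
    by (subst Bochner_Integration.integral_diff)
      (auto simp: Bochner_Integration.integral_sum intro!: Bochner_Integration.integrable_sum, simp add: algebra_simps)
  have bound: "(proj_sq \<omega>)\<^sup>2 \<le> real p * (\<Sum>j<p. col j \<omega> ^ 4)" for \<omega>
  proof -
    have "(proj_sq \<omega>)\<^sup>2 \<le> (\<Sum>j<p. 1 * (col j \<omega>)\<^sup>2)\<^sup>2"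
      using nn[of \<omega>] proj_sq_eq[of \<omega>] by (intro power_mono) auto
    also have "\<dots> \<le> (\<Sum>j<p. 1\<^sup>2) * (\<Sum>j<p. ((col j \<omega>)\<^sup>2)\<^sup>2)"
      by (rule Cauchy_Schwarz_ineq_sum)
    finally show ?thesis by (simp add: power_mult[symmetric])
  qed
  have intB: "integrable M (\<lambda>\<omega>. real p * (\<Sum>j<p. col j \<omega> ^ 4))"
    using col_moments(1) by (intro integrable_mult_right Bochner_Integration.integrable_sum) auto
  have int2: "integrable M (\<lambda>\<omega>. (proj_sq \<omega>)\<^sup>2)"
    by (rule Bochner_Integration.integrable_bound[OF intB])
      (use bound proj_sq_measurable in \<open>auto intro: order_trans[OF _ abs_ge_self]\<close>)
  have "expectation (\<lambda>\<omega>. (proj_sq \<omega>)\<^sup>2) \<le> expectation (\<lambda>\<omega>. real p * (\<Sum>j<p. col j \<omega> ^ 4))"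
    by (rule integral_mono[OF int2 intB bound])
  also have "\<dots> = real p * (\<Sum>j<p. expectation (\<lambda>\<omega>. col j \<omega> ^ 4))"
    using col_moments(1) by simp
  also have "\<dots> \<le> real p * (\<Sum>j<p. 12 * (real n)\<^sup>2)"
    by (intro mult_left_mono sum_mono col_moments(3)) auto
  also have "\<dots> = 12 * (real n)\<^sup>2 * (real p)\<^sup>2" by (simp add: power2_eq_square)
  \<comment> \<open>Here \<open>p \<ge> 2\<close> gives \<open>p \<le> 2 * (p - 1)\<close>, so the
    bound becomes a multiple of the squared mean.\<close>
  also have "\<dots> \<le> 12 * (real n)\<^sup>2 * (2 * (real p - 1))\<^sup>2"
    using p by (intro mult_left_mono power_mono) auto
  also have "\<dots> = 48 * (real n * (real p - 1))\<^sup>2"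
    unfolding power_mult_distrib by simp
  finally have "expectation (\<lambda>\<omega>. (proj_sq \<omega>)\<^sup>2) \<le> 48 * (real n * (real p - 1))\<^sup>2" .
  from paley_zygmund[OF int int2 E _ this] n p show ?thesis by simp
qed

section \<open>Sign flip of the signal coefficients\<close>

text \<open>Written as a function of the coordinate family rather than of the sample point, so that
  equality in law of two families transfers to it.\<close>

definition resid_sq :: "real \<Rightarrow> real \<Rightarrow> (nat + nat \<times> nat \<Rightarrow> real) \<Rightarrow> real" where
  "resid_sq r s f = dot p (cov_residual n p (\<lambda>i j. f (Inl i) * (r * e j) + s * f (Inr (i, j))) e)
     (cov_residual n p (\<lambda>i j. f (Inl i) * (r * e j) + s * f (Inr (i, j))) e)"

lemma resid_sq_measurable: "resid_sq r s \<in> borel_measurable (PiM coords (\<lambda>_. borel))"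
  unfolding resid_sq_def cov_residual_spiked[OF unit] dot_def
  by (intro borel_measurable_sum borel_measurable_times borel_measurable_add borel_measurable_diff
      borel_measurable_const measurable_component_singleton) auto

text \<open>Elements of the product space are restricted to \<open>coords\<close>, whereas the
  family \<open>entry\<close> is total; the values agree because only indices below \<open>n\<close>
  and \<open>p\<close> are read.\<close>

lemma resid_sq_restrict: "resid_sq r s (restrict f coords) = resid_sq r s f"
  unfolding resid_sq_def cov_residual_spiked[OF unit] dot_def
  by (intro sum.cong arg_cong2[where f = "(*)"] arg_cong2[where f = "(+)"] arg_cong2[where f = "(-)"] refl) auto

lemma resid_sq_entry_measurable: "(\<lambda>\<omega>. resid_sq r s (\<lambda>k. entry k \<omega>)) \<in> borel_measurable M"
proof -
  have "(\<lambda>\<omega>. \<lambda>k\<in>coords. entry k \<omega>) \<in> measurable M (PiM coords (\<lambda>_. borel))"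
    using v_measurable z_measurable by (intro measurable_restrict) auto
  from measurable_compose[OF this resid_sq_measurable] show ?thesis
    by (simp add: resid_sq_restrict)
qed

abbreviation flip :: "nat + nat \<times> nat \<Rightarrow> real \<Rightarrow> real" where
  "flip k x \<equiv> (case k of Inl _ \<Rightarrow> - x | Inr _ \<Rightarrow> x)"

text \<open>By independence both laws are products of their marginals, and each marginal is
  preserved because the standard normal law is symmetric. The hypothesis makes \<open>coords\<close>
  nonempty, as the product characterisation of independence requires.\<close>

lemma distr_flip:
  assumes "n > 0"
  shows "distr M (PiM coords (\<lambda>_. borel)) (\<lambda>\<omega>. \<lambda>k\<in>coords. flip k (entry k \<omega>)) =
    distr M (PiM coords (\<lambda>_. borel)) (\<lambda>\<omega>. \<lambda>k\<in>coords. entry k \<omega>)"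
proof -
  have ne: "coords \<noteq> {}" using assms by auto
  have rv: "entry k \<in> borel_measurable M" if "k \<in> coords" for k
    using that v_measurable z_measurable by auto
  have fl: "flip k \<in> borel_measurable borel" for k by (cases k) auto
  have rv': "(\<lambda>\<omega>. flip k (entry k \<omega>)) \<in> borel_measurable M" if "k \<in> coords" for k
    by (rule measurable_compose[OF rv[OF that] fl])
  have ind': "indep_vars (\<lambda>_. borel) (\<lambda>k \<omega>. flip k (entry k \<omega>)) coords"
    by (rule indep_vars_compose2[OF indep fl])
  have "distr M borel (\<lambda>\<omega>. flip k (entry k \<omega>)) = distr M borel (entry k)" if "k \<in> coords" for k
    using that std_normal_distr_uminus[OF v_normal] by auto
  then have "PiM coords (\<lambda>k. distr M borel (\<lambda>\<omega>. flip k (entry k \<omega>))) = PiM coords (\<lambda>k. distr M borel (entry k))"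
    by (intro PiM_cong) auto
  then show ?thesis
    using iffD1[OF indep_vars_iff_distr_eq_PiM'[OF ne rv'] ind']
      iffD1[OF indep_vars_iff_distr_eq_PiM'[OF ne rv] indep]
    by simp
qed

lemma prob_resid_sq_flip:
  assumes "n > 0"
  shows "prob {\<omega> \<in> space M. c \<le> resid_sq r s (\<lambda>k. flip k (entry k \<omega>))} =
    prob {\<omega> \<in> space M. c \<le> resid_sq r s (\<lambda>k. entry k \<omega>)}"
proof -
  let ?P = "PiM coords (\<lambda>_. borel :: real measure)"
  have B: "{f \<in> space ?P. c \<le> resid_sq r s f} \<in> sets ?P"
    using resid_sq_measurable by measurable
  have *: "prob {\<omega> \<in> space M. c \<le> resid_sq r s (\<lambda>k. X k \<omega>)} =
      measure (distr M ?P (\<lambda>\<omega>. \<lambda>k\<in>coords. X k \<omega>)) {f \<in> space ?P. c \<le> resid_sq r s f}"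
    if "\<And>k. k \<in> coords \<Longrightarrow> X k \<in> borel_measurable M" for X
  proof -
    have m: "(\<lambda>\<omega>. \<lambda>k\<in>coords. X k \<omega>) \<in> measurable M ?P"
      using that by (rule measurable_restrict)
    have "(\<lambda>\<omega>. \<lambda>k\<in>coords. X k \<omega>) -` {f \<in> space ?P. c \<le> resid_sq r s f} \<inter> space M =
        {\<omega> \<in> space M. c \<le> resid_sq r s (\<lambda>k. X k \<omega>)}"
      using measurable_space[OF m] by (auto simp: resid_sq_restrict)
    then show ?thesis by (simp add: measure_distr[OF m B])
  qed
  have rv: "entry k \<in> borel_measurable M" if "k \<in> coords" for k
    using that v_measurable z_measurable by auto
  have "(\<lambda>\<omega>. flip k (entry k \<omega>)) \<in> borel_measurable M" if "k \<in> coords" for k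
    using rv[OF that] by (cases k) auto
  from *[OF this] *[OF rv] show ?thesis
    by (simp add: distr_flip[OF assms])
qed

text \<open>If the squared residuals before and after the flip add up to at least twice the
  threshold, one of them reaches it. The two events have equal probability, which halves the
  \<open>1 / 192\<close> of \<open>proj_sq_lower_bound\<close>.\<close>

lemma resid_sq_lower_bound:
  assumes n: "n > 0" and p: "p \<ge> 2"
  shows "prob {\<omega> \<in> space M. (s * r)\<^sup>2 * (real p - 1) / (2 * real n) \<le> resid_sq r s (\<lambda>k. entry k \<omega>)} \<ge> 1 / 384"
proof -
  let ?c = "(s * r)\<^sup>2 * (real p - 1) / (2 * real n)"
  let ?E = "{\<omega> \<in> space M. ?c \<le> resid_sq r s (\<lambda>k. entry k \<omega>)}"
  let ?F = "{\<omega> \<in> space M. ?c \<le> resid_sq r s (\<lambda>k. flip k (entry k \<omega>))}"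
  have key: "2 * (s * r / real n)\<^sup>2 * proj_sq \<omega> \<le> resid_sq r s (\<lambda>k. entry k \<omega>) + resid_sq r s (\<lambda>k. flip k (entry k \<omega>))" for \<omega>
    using cov_residual_spiked_flip[OF unit, where n = n and r = r and s = s and b = "\<lambda>i. v i \<omega>" and y = "\<lambda>i j. z i j \<omega>"]
    by (simp add: resid_sq_def proj_sq_def col_def col_score_def score_def dot_def[of p _ e] mult.commute[of "e _"])
  have "{\<omega> \<in> space M. real n * (real p - 1) / 2 \<le> proj_sq \<omega>} \<subseteq> ?E \<union> ?F"
  proof
    fix \<omega> assume \<omega>: "\<omega> \<in> {\<omega> \<in> space M. real n * (real p - 1) / 2 \<le> proj_sq \<omega>}"
    \<comment> \<open>The threshold \<open>?c\<close> is chosen to match half the mean of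
      \<open>proj_sq\<close> in the flip inequality.\<close>
    have "2 * ?c = 2 * (s * r / real n)\<^sup>2 * (real n * (real p - 1) / 2)"
      using n by (simp add: power2_eq_square field_simps)
    also have "\<dots> \<le> 2 * (s * r / real n)\<^sup>2 * proj_sq \<omega>"
      using \<omega> by (intro mult_left_mono) auto
    finally have "2 * ?c \<le> resid_sq r s (\<lambda>k. entry k \<omega>) + resid_sq r s (\<lambda>k. flip k (entry k \<omega>))"
      using key[of \<omega>] by linarith
    then have "?c \<le> resid_sq r s (\<lambda>k. entry k \<omega>) \<or> ?c \<le> resid_sq r s (\<lambda>k. flip k (entry k \<omega>))"
      by linarith
    then show "\<omega> \<in> ?E \<union> ?F" using \<omega> by blast
  qed
  moreover have E: "?E \<in> events"
    using resid_sq_entry_measurable by measurable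
  moreover have F: "?F \<in> events"
  proof -
    have "(\<lambda>\<omega>. flip k (entry k \<omega>)) \<in> borel_measurable M" if "k \<in> coords" for k
      using that v_measurable z_measurable by auto
    then have "(\<lambda>\<omega>. \<lambda>k\<in>coords. flip k (entry k \<omega>)) \<in> measurable M (PiM coords (\<lambda>_. borel))"
      by (rule measurable_restrict)
    from measurable_compose[OF this resid_sq_measurable]
    have "(\<lambda>\<omega>. resid_sq r s (\<lambda>k. flip k (entry k \<omega>))) \<in> borel_measurable M"
      by (simp add: resid_sq_restrict)
    then show ?thesis by measurable
  qed
  ultimately have "prob {\<omega> \<in> space M. real n * (real p - 1) / 2 \<le> proj_sq \<omega>} \<le> prob (?E \<union> ?F)"
    by (intro finite_measure_mono) auto
  also have "\<dots> \<le> prob ?E + prob ?F"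
    by (rule measure_Un_le[OF E F])
  also have "prob ?F = prob ?E" by (rule prob_resid_sq_flip[OF n])
  finally show ?thesis using proj_sq_lower_bound[OF n p] by linarith
qed

section \<open>The Rayleigh quotient of the spike and the good event\<close>

definition obs :: "real \<Rightarrow> real \<Rightarrow> 'a \<Rightarrow> nat \<Rightarrow> nat \<Rightarrow> real" where
  "obs r s \<omega> = (\<lambda>i j. v i \<omega> * (r * e j) + s * z i j \<omega>)"

lemma cov_form_obs: "cov_form n p (obs r s \<omega>) e e = (\<Sum>i<n. (v i \<omega> * r + s * score i \<omega>)\<^sup>2) / real n"
  unfolding cov_form_def obs_def dot_spiked_row[OF unit]
  by (simp add: score_def dot_def power2_eq_square mult.commute[of "e _"])

lemma cov_form_obs_measurable: "(\<lambda>\<omega>. cov_form n p (obs r s \<omega>) e e) \<in> borel_measurable M"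
  unfolding cov_form_obs using v_measurable score_measurable
  by (intro borel_measurable_divide borel_measurable_sum borel_measurable_power borel_measurable_add
      borel_measurable_times) auto

text \<open>Bounding the square of a sum by twice the sum of the squares removes the cross term; the
  resulting \<open>U\<close> has mean \<open>2 * (r^2 + s^2)\<close>, and Markov's inequality
  applies to it.\<close>

lemma cov_form_obs_upper_bound:
  assumes n: "n > 0" and K: "K > 0"
  shows "prob {\<omega> \<in> space M. K \<le> cov_form n p (obs r s \<omega>) e e} \<le> 2 * (r\<^sup>2 + s\<^sup>2) / K"
proof -
  define U where "U \<omega> = (\<Sum>i<n. 2 * r\<^sup>2 * (v i \<omega>)\<^sup>2 + 2 * s\<^sup>2 * (score i \<omega>)\<^sup>2) / real n" for \<omega>
  have le: "cov_form n p (obs r s \<omega>) e e \<le> U \<omega>" for \<omega>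
    unfolding cov_form_obs U_def
  proof (intro divide_right_mono sum_mono)
    fix i
    have "0 \<le> (v i \<omega> * r - s * score i \<omega>)\<^sup>2" by simp
    then show "(v i \<omega> * r + s * score i \<omega>)\<^sup>2 \<le> 2 * r\<^sup>2 * (v i \<omega>)\<^sup>2 + 2 * s\<^sup>2 * (score i \<omega>)\<^sup>2"
      by (simp add: power2_eq_square algebra_simps)
  qed simp
  note m = std_normal_moments(1)[OF v_normal, of _ 2] score_moments(1)[of _ 2]
  have int: "integrable M U"
    unfolding U_def using m
    by (intro integrable_divide Bochner_Integration.integrable_sum Bochner_Integration.integrable_add
        integrable_mult_right) auto
  have "expectation U = (\<Sum>i<n. 2 * r\<^sup>2 * expectation (\<lambda>\<omega>. (v i \<omega>)\<^sup>2) + 2 * s\<^sup>2 * expectation (\<lambda>\<omega>. (score i \<omega>)\<^sup>2)) / real n"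
    unfolding U_def using m by simp
  also have "\<dots> = 2 * (r\<^sup>2 + s\<^sup>2)"
    using n std_normal_moments(3)[OF v_normal] score_moments(3) by simp
  finally have E: "expectation U = 2 * (r\<^sup>2 + s\<^sup>2)" .
  have "{\<omega> \<in> space M. K \<le> U \<omega>} \<in> events"
    using borel_measurable_integrable[OF int] by measurable
  then have "prob {\<omega> \<in> space M. K \<le> cov_form n p (obs r s \<omega>) e e} \<le> prob {\<omega> \<in> space M. K \<le> U \<omega>}"
    using le by (intro finite_measure_mono) (auto intro: order_trans)
  also have "\<dots> \<le> expectation U / K"
    by (rule integral_Markov_inequality_measure[OF int sets.empty_sets])
      (use K in \<open>auto simp: U_def intro!: AE_I2 divide_nonneg_nonneg sum_nonneg\<close>)
  finally show ?thesis unfolding E .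
qed

text \<open>The constant 1536 makes the Markov failure probability at most
  \<open>2 / 1536 = 1 / 768\<close>, half of the \<open>1 / 384\<close> guaranteed for the
  residual.\<close>

lemma good_event:
  assumes n: "n > 0" and p: "p \<ge> 2" and d: "d\<^sup>2 \<le> (s * r)\<^sup>2 * (real p - 1) / (2 * real n)"
    and K: "1536 * (r\<^sup>2 + s\<^sup>2) \<le> K" "K > 0"
  defines "G \<equiv> {\<omega> \<in> space M. cov_form n p (obs r s \<omega>) e e \<le> K \<and>
      d\<^sup>2 \<le> dot p (cov_residual n p (obs r s \<omega>) e) (cov_residual n p (obs r s \<omega>) e)}"
  shows "G \<in> events" "prob G \<ge> 1 / 768"
proof -
  have eq: "dot p (cov_residual n p (obs r s \<omega>) e) (cov_residual n p (obs r s \<omega>) e) =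
      resid_sq r s (\<lambda>k. entry k \<omega>)" for \<omega>
    by (simp add: obs_def resid_sq_def)
  note [measurable] = resid_sq_entry_measurable cov_form_obs_measurable
  show G: "G \<in> events" unfolding G_def eq by measurable
  let ?E = "{\<omega> \<in> space M. (s * r)\<^sup>2 * (real p - 1) / (2 * real n) \<le> resid_sq r s (\<lambda>k. entry k \<omega>)}"
  let ?B = "{\<omega> \<in> space M. K \<le> cov_form n p (obs r s \<omega>) e e}"
  have B: "?B \<in> events" by measurable
  have "prob ?E \<le> prob (G \<union> ?B)"
    using G B d by (intro finite_measure_mono) (auto simp: G_def eq)
  also have "\<dots> \<le> prob G + prob ?B" by (rule measure_Un_le[OF G B])
  also have "prob ?B \<le> 1 / 768"
    by (rule order_trans[OF cov_form_obs_upper_bound[OF n K(2)]]) (use K in \<open>simp add: field_simps\<close>)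
  finally show "prob G \<ge> 1 / 768"
    using resid_sq_lower_bound[OF n p, of s r] by linarith
qed

end

section \<open>Inconsistency\<close>

lemma vangle_eq_arccos_dot:
  fixes u w :: "real vec"
  assumes "w \<in> carrier_vec p" "w \<bullet> w > 0" "u \<bullet> u = 1"
  shows "vangle u w = arccos \<bar>dot p (vec_index u) (\<lambda>j. w $ j / sqrt (w \<bullet> w))\<bar>"
proof -
  have "dot p (vec_index u) (\<lambda>j. w $ j / sqrt (w \<bullet> w)) = (u \<bullet> w) / sqrt (w \<bullet> w)"
    using dot_linear_right(3)[of p "vec_index u" "1 / sqrt (w \<bullet> w)" "vec_index w"]
    by (simp add: scalar_prod_eq_dot[OF assms(1)])
  then show ?thesis using assms(2,3) by (simp add: vangle_def)
qed

text \<open>The sine of a nonnegative angle is at most the angle; the bound by \<open>pi\<close>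
  serves for integrability.\<close>

lemma sqrt_le_arccos_abs:
  assumes "t\<^sup>2 \<le> 1"
  shows "sqrt (1 - t\<^sup>2) \<le> arccos \<bar>t\<bar>" "0 \<le> arccos \<bar>t\<bar>" "arccos \<bar>t\<bar> \<le> pi"
proof -
  have t: "\<bar>t\<bar> \<le> 1" using assms by (simp add: abs_square_le_1)
  then show 0: "0 \<le> arccos \<bar>t\<bar>" by (intro arccos_lbound) auto
  show "arccos \<bar>t\<bar> \<le> pi" using t by (intro arccos_ubound) auto
  have "sqrt (1 - t\<^sup>2) = sin (arccos \<bar>t\<bar>)" using t by (subst sin_arccos) auto
  also have "\<dots> \<le> arccos \<bar>t\<bar>" using 0 by (rule sin_x_le_x)
  finally show "sqrt (1 - t\<^sup>2) \<le> arccos \<bar>t\<bar>" .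
qed

text \<open>On the good event the angle is at least the sine bound, elsewhere it is nonnegative, so
  its mean is at least that bound times the probability of the event.\<close>

lemma (in gaussian_design) expectation_angle_lower_bound:
  assumes n: "n > 0" and p: "p \<ge> 2" and d: "d\<^sup>2 \<le> (s * r)\<^sup>2 * (real p - 1) / (2 * real n)" "d \<ge> 0"
    and K: "1536 * (r\<^sup>2 + s\<^sup>2) \<le> K" "K > 0"
    and u: "\<And>\<omega>. \<omega> \<in> space M \<Longrightarrow> top_unit_eigenvector (sample_cov n p (obs r s \<omega>)) (u \<omega>)"
    and meas: "(\<lambda>\<omega>. arccos \<bar>dot p (vec_index (u \<omega>)) e\<bar>) \<in> borel_measurable M"
  shows "min (1/4) (d / (8 * K)) / 768 \<le> expectation (\<lambda>\<omega>. arccos \<bar>dot p (vec_index (u \<omega>)) e\<bar>)"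
proof -
  define \<eta> where "\<eta> = min (1/4) (d / (8 * K))"
  define \<theta> where "\<theta> \<omega> = arccos \<bar>dot p (vec_index (u \<omega>)) e\<bar>" for \<omega>
  define G where "G = {\<omega> \<in> space M. cov_form n p (obs r s \<omega>) e e \<le> K \<and>
      d\<^sup>2 \<le> dot p (cov_residual n p (obs r s \<omega>) e) (cov_residual n p (obs r s \<omega>) e)}"
  note G = good_event[OF n p d(1) K, folded G_def]
  have \<eta>: "\<eta> \<ge> 0" using d K by (simp add: \<eta>_def)
  have t1: "(dot p (vec_index (u \<omega>)) e)\<^sup>2 \<le> 1" if "\<omega> \<in> space M" for \<omega>
    using top_unit_eigenvectorD[OF u[OF that]] dot_Cauchy_Schwarz[of p "vec_index (u \<omega>)" e] unit
    by (metis mult_1)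
  have bnd: "0 \<le> \<theta> \<omega>" "\<theta> \<omega> \<le> pi" if "\<omega> \<in> space M" for \<omega>
    unfolding \<theta>_def using sqrt_le_arccos_abs[OF t1[OF that]] by auto
  \<comment> \<open>Measurability and boundedness give integrability, so the expectation is not the
    default value zero.\<close>
  have int: "integrable M \<theta>"
    using meas bnd unfolding \<theta>_def[symmetric]
    by (intro integrable_const_bound[where B = pi]) auto
  have le: "\<eta> * indicator G \<omega> \<le> \<theta> \<omega>" if \<omega>: "\<omega> \<in> space M" for \<omega>
  proof (cases "\<omega> \<in> G")
    case True
    obtain l where l: "dot p (vec_index (u \<omega>)) (vec_index (u \<omega>)) = 1"
      "\<And>j. j < p \<Longrightarrow> cov_map n p (obs r s \<omega>) (vec_index (u \<omega>)) j = l * vec_index (u \<omega>) j"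
      "\<And>f. cov_form n p (obs r s \<omega>) f f \<le> l * dot p f f"
      using top_unit_eigenvectorD[OF u[OF \<omega>]] by metis
    have "\<eta> \<le> sqrt (1 - (dot p (vec_index (u \<omega>)) e)\<^sup>2)"
      unfolding \<eta>_def
      by (rule sin_eigenvector_lower_bound[OF l(1) unit l(2,3)]) (use True d K in \<open>auto simp: G_def\<close>)
    also have "\<dots> \<le> \<theta> \<omega>" unfolding \<theta>_def by (rule sqrt_le_arccos_abs[OF t1[OF \<omega>]])
    finally show ?thesis using True by simp
  qed (use bnd \<omega> in simp)
  have iG: "integrable M (\<lambda>\<omega>. \<eta> * indicator G \<omega>)"
    by (intro integrable_mult_right integrable_real_indicator[OF G(1)]) (simp add: less_top[symmetric])
  have "\<eta> / 768 \<le> \<eta> * prob G"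
    using mult_left_mono[OF G(2) \<eta>] by simp
  also have "\<dots> = expectation (\<lambda>\<omega>. \<eta> * indicator G \<omega>)"
    using G(1) by simp
  also have "\<dots> \<le> expectation \<theta>"
    by (rule integral_mono[OF iG int le])
  finally show ?thesis unfolding \<eta>_def \<theta>_def .
qed

text \<open>Each sample size has its own probability space, and the proof uses only bounds at fixed
  \<open>n\<close> whose constants depend on the limits and on \<open>\<sigma>\<close>.
  Measurability of the angle is assumed because \<open>\<rho>hat\<close> is an arbitrary pointwise
  choice of eigenvector.\<close>

theorem theorem2:
  fixes M :: "nat \<Rightarrow> 'a measure"
    and p :: "nat \<Rightarrow> nat"
    and \<rho> :: "nat \<Rightarrow> real vec"
    and \<sigma> \<rho>0 c :: real
    and v :: "nat \<Rightarrow> nat \<Rightarrow> 'a \<Rightarrow> real"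
    and z :: "nat \<Rightarrow> nat \<Rightarrow> nat \<Rightarrow> 'a \<Rightarrow> real"
    and \<rho>hat :: "nat \<Rightarrow> 'a \<Rightarrow> real vec"
  assumes prob: "\<And>n. prob_space (M n)"
    and dim_rho: "\<And>n. \<rho> n \<in> carrier_vec (p n)"
    and sigma_pos: "\<sigma> > 0"
    and v_normal: "\<And>n i. i < n \<Longrightarrow> distributed (M n) lborel (v n i) std_normal_density"
    and z_normal: "\<And>n i j. i < n \<Longrightarrow> j < p n \<Longrightarrow>
                     distributed (M n) lborel (z n i j) std_normal_density"
    and indep: "\<And>n. prob_space.indep_vars (M n) (\<lambda>_. borel)
                  (\<lambda>k. case k of Inl i \<Rightarrow> v n i | Inr (i, j) \<Rightarrow> z n i j)
                  (Inl ` {..<n} \<union> Inr ` ({..<n} \<times> {..<p n}))"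
    and rho_lim: "(\<lambda>n. sqrt (\<rho> n \<bullet> \<rho> n)) \<longlonglongrightarrow> \<rho>0" and rho0_pos: "\<rho>0 > 0"
    and p_lim: "(\<lambda>n. real (p n) / real n) \<longlonglongrightarrow> c" and c_pos: "0 < c"
    and rhohat_eig: "\<And>n \<omega>. \<omega> \<in> space (M n) \<Longrightarrow>
          top_unit_eigenvector
            (sample_cov n (p n) (\<lambda>i j. v n i \<omega> * (\<rho> n $ j) + \<sigma> * z n i j \<omega>))
            (\<rho>hat n \<omega>)"
    and rhohat_meas: "\<And>n. (\<lambda>\<omega>. vangle (\<rho>hat n \<omega>) (\<rho> n)) \<in> borel_measurable (M n)"
  shows "liminf (\<lambda>n. ereal (\<integral>\<omega>. vangle (\<rho>hat n \<omega>) (\<rho> n) \<partial>M n)) > 0"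
proof -
  define r where "r n = sqrt (\<rho> n \<bullet> \<rho> n)" for n
  \<comment> \<open>For large \<open>n\<close> the length \<open>r n\<close> lies between
    \<open>\<rho>0 / 2\<close> and \<open>2 * \<rho>0\<close>, and \<open>(p n - 1) / n\<close>
    exceeds \<open>c / 2\<close>. Inserting the lower bounds into the residual threshold gives
    \<open>d\<close>; inserting the upper bound into the Markov constant gives
    \<open>K\<close>.\<close>
  define d where "d = sqrt (\<sigma>\<^sup>2 * (\<rho>0 / 2)\<^sup>2 * c / 4)"
  define K where "K = 1536 * ((2 * \<rho>0)\<^sup>2 + \<sigma>\<^sup>2)"
  define \<eta> where "\<eta> = min (1/4) (d / (8 * K)) / 768"
  have d0: "d > 0" using sigma_pos rho0_pos c_pos by (simp add: d_def)
  have d2: "d\<^sup>2 = \<sigma>\<^sup>2 * (\<rho>0 / 2)\<^sup>2 * c / 4" using c_pos by (simp add: d_def)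
  have K0: "K > 0" using sigma_pos by (simp add: K_def add_nonneg_pos)
  have \<eta>0: "\<eta> > 0" using d0 K0 by (simp add: \<eta>_def)
  have "(\<lambda>n. real (p n) / real n - 1 / real n) \<longlonglongrightarrow> c - 0"
    by (intro tendsto_diff p_lim lim_1_over_n)
  then have ev1: "\<forall>\<^sub>F n in sequentially. c / 2 < real (p n) / real n - 1 / real n"
    using c_pos by (intro order_tendstoD) auto
  have ev2: "\<forall>\<^sub>F n in sequentially. \<rho>0 / 2 < r n"
    unfolding r_def by (rule order_tendstoD[OF rho_lim]) (use rho0_pos in simp)
  have ev2': "\<forall>\<^sub>F n in sequentially. r n < 2 * \<rho>0"
    unfolding r_def by (rule order_tendstoD[OF rho_lim]) (use rho0_pos in simp)
  \<comment> \<open>Together with \<open>ev1\<close> this yields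
    \<open>p n - 1 > c / 2 * n > 1\<close>, hence \<open>p n \<ge> 2\<close>.\<close>
  have ev3: "\<forall>\<^sub>F n in sequentially. 2 / c < real n"
    by (rule eventually_compose_filterlim[OF eventually_gt_at_top filterlim_real_sequentially])
  have "\<forall>\<^sub>F n in sequentially. \<eta> \<le> (\<integral>\<omega>. vangle (\<rho>hat n \<omega>) (\<rho> n) \<partial>M n)"
    using ev1 ev2 ev2' ev3
  proof eventually_elim
    case (elim n)
    have "0 < 2 / c" using c_pos by simp
    with elim have n: "real n > 0" by linarith
    have "1 < c / 2 * real n" using elim c_pos by (simp add: field_simps)
    also have "c / 2 * real n < real (p n) - 1"
      using elim n by (simp add: field_simps)
    finally have p: "p n \<ge> 2" by linarith
    have r: "r n > 0" using elim rho0_pos by linarith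
    have rr: "\<rho> n \<bullet> \<rho> n > 0" using r by (simp add: r_def)
    \<comment> \<open>Normalising writes \<open>\<rho> n\<close> as \<open>r n\<close> times a unit
      vector, the setting of \<open>gaussian_design\<close>.\<close>
    define e where "e j = \<rho> n $ j / r n" for j
    have "dot (p n) e e = dot (p n) (vec_index (\<rho> n)) (vec_index (\<rho> n)) / (r n * r n)"
      by (simp add: dot_def e_def sum_divide_distrib)
    also have "\<dots> = 1"
      using rr unfolding scalar_prod_eq_dot[OF dim_rho, symmetric] by (simp add: r_def)
    finally have unit: "dot (p n) e e = 1" .
    interpret prob_space "M n" by (rule prob)
    interpret gaussian_design "M n" n "p n" "v n" "z n" e
      by unfold_locales (use v_normal z_normal indep unit in auto)
    have obs: "obs (r n) \<sigma> \<omega> = (\<lambda>i j. v n i \<omega> * (\<rho> n $ j) + \<sigma> * z n i j \<omega>)" for \<omega>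
      using r by (simp add: obs_def e_def)
    have u: "top_unit_eigenvector (sample_cov n (p n) (obs (r n) \<sigma> \<omega>)) (\<rho>hat n \<omega>)"
      if "\<omega> \<in> space (M n)" for \<omega>
      unfolding obs by (rule rhohat_eig[OF that])
    have angle: "vangle (\<rho>hat n \<omega>) (\<rho> n) = arccos \<bar>dot (p n) (vec_index (\<rho>hat n \<omega>)) e\<bar>"
      if "\<omega> \<in> space (M n)" for \<omega>
      using vangle_eq_arccos_dot[OF dim_rho rr, of "\<rho>hat n \<omega>"] u[OF that]
      by (simp add: top_unit_eigenvector_def e_def[abs_def] r_def)
    have "d\<^sup>2 = (\<sigma> * (\<rho>0 / 2))\<^sup>2 * (c / 2) / 2"
      unfolding d2 power_mult_distrib by simp
    also have "\<dots> \<le> (\<sigma> * r n)\<^sup>2 * (real (p n) / real n - 1 / real n) / 2"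
      using elim sigma_pos rho0_pos c_pos
      by (intro divide_right_mono mult_mono power_mono mult_left_mono) auto
    also have "\<dots> = (\<sigma> * r n)\<^sup>2 * (real (p n) - 1) / (2 * real n)"
      by (simp add: diff_divide_distrib[symmetric])
    finally have d: "d\<^sup>2 \<le> (\<sigma> * r n)\<^sup>2 * (real (p n) - 1) / (2 * real n)" .
    have "(r n)\<^sup>2 \<le> (2 * \<rho>0)\<^sup>2" using elim r by (intro power_mono) auto
    then have K: "1536 * ((r n)\<^sup>2 + \<sigma>\<^sup>2) \<le> K" by (simp add: K_def)
    have meas: "(\<lambda>\<omega>. arccos \<bar>dot (p n) (vec_index (\<rho>hat n \<omega>)) e\<bar>) \<in> borel_measurable (M n)"
      using rhohat_meas[of n] by (simp add: angle cong: measurable_cong)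
    have "\<eta> \<le> expectation (\<lambda>\<omega>. arccos \<bar>dot (p n) (vec_index (\<rho>hat n \<omega>)) e\<bar>)"
      unfolding \<eta>_def
      by (rule expectation_angle_lower_bound[OF _ p d _ K K0 u meas]) (use n d0 in auto)
    also have "\<dots> = (\<integral>\<omega>. vangle (\<rho>hat n \<omega>) (\<rho> n) \<partial>M n)"
      by (rule Bochner_Integration.integral_cong) (auto simp: angle)
    finally show ?case .
  qed
  then have "ereal \<eta> \<le> liminf (\<lambda>n. ereal (\<integral>\<omega>. vangle (\<rho>hat n \<omega>) (\<rho> n) \<partial>M n))"
    by (intro Liminf_bounded) simp
  moreover have "0 < ereal \<eta>" using \<eta>0 by simp
  ultimately show ?thesis by (rule less_le_trans[rotated])
qed

end
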